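(* Let $u_L$ be the solution of $u_t=\int_{\mathbb R^N}J(x-y)(u(y,t)-u(x,t))\,dy$ in $\mathbb R^N\times(0,\infty)$ with initial datum $u_0$ satisfying the assumptions listed in the context. There exists a constant $C$ depending only on $\|u_0\|_\infty$, $B$, $N$, $J$ such that $$f(t^{1/2})\,u_L(x,t)\le C,\qquad f(|x|)\,u_L(x,t)\le C .$$ In particular, if $\mu>0$ is such that $k^\mu\le Cf(k)$ for $k\ge1$, there holds that $$u_L(x,t)\le\frac{C}{(1+t^{1/2}+|x|)^\mu}.$$ This is always the case when $\mu=\frac2{p-1}$.
   Context: $J\in C_0^\infty(\mathbb R^N)$ is radially symmetric, $J\ge0$, $\int J=1$; $p>1$ is the exponent appearing in (F3) below. Assumptions on $u_0$: $0\le u_0\in L^\infty(\mathbb R^N)$, $u_0\neq0$, and there is $\kappa>0$ with $\int_{B_k}u_0\ge\kappa k^N$ for $k>0$ small, where $B_k$ is the ball of radius $k$ centered at $0$. Put $$f(k)=\frac{k^N}{\int_{B_k}u_0}.$$ Assume: (F1) there is $B>0$ with $f(|x|)u_0(x)\le B$; (F2) with some fixed $k_0>0$, for every $\delta>0$ there is $C_\delta>0$ with $f(k)\le C_\delta f(l)$ whenever $k_0\le k\le l\delta^{-1}$; (F3) there is $c_0\ge0$ with $f(k)^{1-p}k^2\to c_0$ as $k\to\infty$.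
   Formalization: The constant C may also depend on the constants κ, k_0, C_δ of the assumptions and on the range of "k small" (and, in the decay bound, on μ and the constant in k^μ ≤ Cf(k)); dependence on ‖u_0‖_∞, B, N, J alone is false. *)

theory Defs
  imports "HOL-Analysis.Analysis" "HOL-Probability.Essential_Supremum"
begin

fun C_k :: "nat \<Rightarrow> ('a::euclidean_space \<Rightarrow> real) \<Rightarrow> bool" where
  "C_k 0 g \<longleftrightarrow> continuous_on UNIV g"
| "C_k (Suc n) g \<longleftrightarrow>
     (\<forall>x. g differentiable (at x)) \<and> (\<forall>b\<in>Basis. C_k n (\<lambda>x. frechet_derivative g (at x) b))"

definition smooth_compact_support :: "('a::euclidean_space \<Rightarrow> real) \<Rightarrow> bool" where
  "smooth_compact_support g \<longleftrightarrow> (\<forall>n. C_k n g) \<and> compact (closure {x. g x \<noteq> 0})"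

definition diffusion_kernel :: "('a::euclidean_space \<Rightarrow> real) \<Rightarrow> bool" where
  "diffusion_kernel J \<longleftrightarrow>
     smooth_compact_support J \<and>
     (\<forall>x y. norm x = norm y \<longrightarrow> J x = J y) \<and>
     (\<forall>x. 0 \<le> J x) \<and>
     (LINT x|lebesgue. J x) = 1"

(* Functions stand for their classes modulo null sets; the value is \<infinity> for g not in L-infinity
   and for non-measurable g. *)
definition Linf_norm :: "('a::euclidean_space \<Rightarrow> real) \<Rightarrow> ereal" where
  "Linf_norm g = esssup lebesgue (\<lambda>x. ereal \<bar>g x\<bar>)"

definition mass_ratio :: "('a::euclidean_space \<Rightarrow> real) \<Rightarrow> real \<Rightarrow> real" where
  "mass_ratio u0 k = k ^ DIM('a) / (LINT x:ball 0 k|lebesgue. u0 x)"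

(* M is the L-infinity norm of u0; \<kappa> and k1 quantify the lower bound on the mass of small balls. *)
definition initial_datum :: "real \<Rightarrow> real \<Rightarrow> real \<Rightarrow> ('a::euclidean_space \<Rightarrow> real) \<Rightarrow> bool" where
  "initial_datum M \<kappa> k1 u0 \<longleftrightarrow>
     u0 \<in> borel_measurable lebesgue \<and>
     Linf_norm u0 = ereal M \<and>
     (AE x in lebesgue. 0 \<le> u0 x) \<and>
     \<not> (AE x in lebesgue. u0 x = 0) \<and>
     \<kappa> > 0 \<and> k1 > 0 \<and>
     (\<forall>k. 0 < k \<and> k < k1 \<longrightarrow> (LINT x:ball 0 k|lebesgue. u0 x) \<ge> \<kappa> * k ^ DIM('a))"

definition F1 :: "real \<Rightarrow> ('a::euclidean_space \<Rightarrow> real) \<Rightarrow> bool" where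
  "F1 B u0 \<longleftrightarrow> B > 0 \<and> (AE x in lebesgue. mass_ratio u0 (norm x) * u0 x \<le> B)"

(* D \<delta> is the constant written with subscript \<delta> in the condition. *)
definition F2 :: "real \<Rightarrow> (real \<Rightarrow> real) \<Rightarrow> ('a::euclidean_space \<Rightarrow> real) \<Rightarrow> bool" where
  "F2 k0 D u0 \<longleftrightarrow> k0 > 0 \<and>
     (\<forall>\<delta>>0. D \<delta> > 0 \<and>
        (\<forall>k l. k0 \<le> k \<and> k \<le> l * inverse \<delta> \<longrightarrow> mass_ratio u0 k \<le> D \<delta> * mass_ratio u0 l))"

definition F3 :: "real \<Rightarrow> real \<Rightarrow> ('a::euclidean_space \<Rightarrow> real) \<Rightarrow> bool" where
  "F3 p c0 u0 \<longleftrightarrow> p > 1 \<and> c0 \<ge> 0 \<and>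
     ((\<lambda>k. mass_ratio u0 k powr (1 - p) * k ^ 2) \<longlongrightarrow> c0) at_top"

(* The solution of u_t = J * u - u with initial datum u0, up to null sets in x. Boundedness on
   bounded time intervals, implicit in the L-infinity theory, is what makes it unique. *)
definition nonlocal_solution ::
  "('a::euclidean_space \<Rightarrow> real) \<Rightarrow> ('a \<Rightarrow> real) \<Rightarrow> ('a \<Rightarrow> real \<Rightarrow> real) \<Rightarrow> bool" where
  "nonlocal_solution J u0 u \<longleftrightarrow>
     (\<forall>t\<ge>0. (\<lambda>x. u x t) \<in> borel_measurable lebesgue) \<and>
     (\<forall>T\<ge>0. \<exists>K. \<forall>t\<in>{0..T}. AE x in lebesgue. \<bar>u x t\<bar> \<le> K) \<and>
     (AE x in lebesgue.
        u x 0 = u0 x \<and> continuous_on {0..} (u x) \<and>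
        (\<forall>t>0. (u x has_real_derivative (LINT y|lebesgue. J (x - y) * (u y t - u x t))) (at t)))"

end

theory Submission
  imports Defs
begin

text \<open>The solution is at most \<open>exp (- t)\<close> times the exponential series in \<open>t\<close> of the convolution
  powers of \<open>J\<close> applied to the datum. Split the datum \<open>u\<^sub>0\<close> at the sphere of radius \<open>s\<close>. The far part is at
  most \<open>B / f(|y|)\<close> by (F1), hence of order \<open>1 / f(s)\<close> by (F2), and convolution preserves this. The near part has mass
  \<open>s\<^sup>N / f(s)\<close>, so it suffices to bound the convolution semigroup from \<open>L\<^sup>1\<close> to \<open>L\<^sup>\<infinity>\<close> by \<open>t\<^sup>-\<^sup>N\<^sup>/\<^sup>2\<close>, up to
  a term decaying exponentially in \<open>t\<close>; then \<open>s = t\<^sup>1\<^sup>/\<^sup>2\<close> gives the first bound. For the second one take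
  \<open>s = |x| / 2\<close> and tilt the kernel by \<open>exp (l \<bullet> z)\<close> with \<open>l\<close> parallel to \<open>x\<close> and of length
  \<open>min 1 (t\<^sup>-\<^sup>1\<^sup>/\<^sup>2)\<close>: as \<open>J\<close> is even, this increases the mass of the kernel by \<open>O(|l|\<^sup>2) = O(1 / t)\<close> only, and it
  gains the factor \<open>exp (- |l| |x| / 2)\<close>.

  The bound from \<open>L\<^sup>1\<close> to \<open>L\<^sup>\<infinity>\<close> uses no Fourier transform. The kernel dominates a multiple of the
  uniform density on a box. That density is the box of half the side convolved with the uniform measure on
  the vertices of a box, so its \<open>j\<close>-th convolution power is bounded by a product of \<open>N\<close> binomial
  probabilities, each at most \<open>(j + 1)\<^sup>-\<^sup>1\<^sup>/\<^sup>2\<close>; averaging over a Poisson distributed \<open>j\<close> gives the claim.\<close>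

section \<open>Iterated convolution\<close>

lemma nn_integral_lborel_translate:
  fixes f :: "'a::euclidean_space \<Rightarrow> ennreal"
  assumes [measurable]: "f \<in> borel_measurable borel"
  shows "(\<integral>\<^sup>+ y. f (a + y) \<partial>lborel) = (\<integral>\<^sup>+ y. f y \<partial>lborel)"
proof -
  have "(\<integral>\<^sup>+ y. f y \<partial>lborel) = (\<integral>\<^sup>+ y. f y \<partial>distr lborel borel ((+) a))"
    by (simp add: lborel_distr_plus)
  also have "\<dots> = (\<integral>\<^sup>+ y. f (a + y) \<partial>lborel)"
    by (subst nn_integral_distr) auto
  finally show ?thesis by simp
qed

lemma nn_integral_lborel_reflect:
  fixes f :: "'a::euclidean_space \<Rightarrow> ennreal"
  assumes [measurable]: "f \<in> borel_measurable borel"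
  shows "(\<integral>\<^sup>+ y. f (a - y) \<partial>lborel) = (\<integral>\<^sup>+ y. f y \<partial>lborel)"
proof -
  \<comment> \<open>The affine map with factor -1 has Jacobian |-1|^N = 1, hence the constant
    density 1.\<close>
  have eq: "(lborel :: 'a measure) = density (distr lborel borel (\<lambda>x. a + (-1) *\<^sub>R x)) (\<lambda>_. 1)"
    by (subst lborel_affine[of "-1" a]) auto
  have "(\<integral>\<^sup>+ y. f y \<partial>lborel) = (\<integral>\<^sup>+ y. f y \<partial>density (distr lborel borel (\<lambda>x. a + (-1) *\<^sub>R x)) (\<lambda>_. 1))"
    using eq by simp
  also have "\<dots> = (\<integral>\<^sup>+ y. f (a - y) \<partial>lborel)"
    by (simp add: density_1 nn_integral_distr)
  finally show ?thesis by simp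
qed

text \<open>Values in \<open>ennreal\<close> free Tonelli's theorem, and with it the algebra of
  convolution, from integrability conditions.\<close>

definition nn_conv :: "('a::euclidean_space \<Rightarrow> ennreal) \<Rightarrow> ('a \<Rightarrow> ennreal) \<Rightarrow> 'a \<Rightarrow> ennreal" where
  "nn_conv k v x = (\<integral>\<^sup>+ y. k (x - y) * v y \<partial>lborel)"

lemma nn_conv_measurable [measurable]:
  fixes k v :: "'a::euclidean_space \<Rightarrow> ennreal"
  assumes [measurable]: "k \<in> borel_measurable borel" "v \<in> borel_measurable borel"
  shows "nn_conv k v \<in> borel_measurable borel"
proof -
  have "(\<lambda>x. \<integral>\<^sup>+ y. k (x - y) * v y \<partial>lborel) \<in> borel_measurable (borel :: 'a measure)"
    by measurable
  then show ?thesis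
    by (simp add: nn_conv_def[abs_def])
qed

lemma nn_conv_pow_measurable [measurable]:
  assumes [measurable]: "k \<in> borel_measurable borel" "v \<in> borel_measurable borel"
  shows "(nn_conv k ^^ n) v \<in> borel_measurable borel"
  by (induction n) auto

lemma nn_conv_commute:
  fixes k v :: "'a::euclidean_space \<Rightarrow> ennreal"
  assumes [measurable]: "k \<in> borel_measurable borel" "v \<in> borel_measurable borel"
  shows "nn_conv k v = nn_conv v k"
proof
  fix x
  have "(\<integral>\<^sup>+ y. k (x - y) * v (x - (x - y)) \<partial>lborel) = (\<integral>\<^sup>+ y. k y * v (x - y) \<partial>lborel)"
    by (rule nn_integral_lborel_reflect) auto
  then show "nn_conv k v x = nn_conv v k x"
    by (simp add: nn_conv_def mult.commute)
qed

lemma nn_conv_assoc: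
  fixes k v w :: "'a::euclidean_space \<Rightarrow> ennreal"
  assumes [measurable]: "k \<in> borel_measurable borel" "v \<in> borel_measurable borel"
    "w \<in> borel_measurable borel"
  shows "nn_conv (nn_conv k v) w = nn_conv k (nn_conv v w)"
proof
  fix x
  have "nn_conv k (nn_conv v w) x = (\<integral>\<^sup>+ y. (\<integral>\<^sup>+ z. k (x - y) * (v (y - z) * w z) \<partial>lborel) \<partial>lborel)"
    by (simp add: nn_conv_def nn_integral_cmult)
  also have "\<dots> = (\<integral>\<^sup>+ z. (\<integral>\<^sup>+ y. k (x - y) * (v (y - z) * w z) \<partial>lborel) \<partial>lborel)"
    by (rule lborel_pair.Fubini') measurable
  also have "\<dots> = (\<integral>\<^sup>+ z. nn_conv k v (x - z) * w z \<partial>lborel)"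
  proof (intro nn_integral_cong)
    fix z
    have "(\<integral>\<^sup>+ y. k (x - y) * (v (y - z) * w z) \<partial>lborel)
        = (\<integral>\<^sup>+ y. k (x - y) * v (y - z) \<partial>lborel) * w z"
      by (simp add: mult.assoc[symmetric] nn_integral_multc)
    also have "(\<integral>\<^sup>+ y. k (x - y) * v (y - z) \<partial>lborel)
        = (\<integral>\<^sup>+ y. k (x - (z + y)) * v ((z + y) - z) \<partial>lborel)"
      by (rule nn_integral_lborel_translate[symmetric]) auto
    also have "\<dots> = nn_conv k v (x - z)"
      by (simp add: nn_conv_def diff_diff_add)
    finally show "(\<integral>\<^sup>+ y. k (x - y) * (v (y - z) * w z) \<partial>lborel) = nn_conv k v (x - z) * w z" .
  qed
  finally show "nn_conv (nn_conv k v) w x = nn_conv k (nn_conv v w) x"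
    by (simp add: nn_conv_def)
qed

lemma nn_conv_left_commute:
  fixes k v w :: "'a::euclidean_space \<Rightarrow> ennreal"
  assumes [measurable]: "k \<in> borel_measurable borel" "v \<in> borel_measurable borel"
    "w \<in> borel_measurable borel"
  shows "nn_conv k (nn_conv v w) = nn_conv v (nn_conv k w)"
  by (metis assms nn_conv_assoc nn_conv_commute)

lemma nn_conv_pow_commute:
  fixes k v w :: "'a::euclidean_space \<Rightarrow> ennreal"
  assumes [measurable]: "k \<in> borel_measurable borel" "v \<in> borel_measurable borel"
    "w \<in> borel_measurable borel"
  shows "nn_conv k ((nn_conv v ^^ n) w) = (nn_conv v ^^ n) (nn_conv k w)"
  by (induction n) (simp_all add: nn_conv_left_commute[of k v])

text \<open>Lets an iterate of the operator be read as convolution with a single kernel, so that a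
  sup bound on that kernel becomes a bound from L1 to L-infinity.\<close>

lemma nn_conv_pow_assoc:
  fixes k v w :: "'a::euclidean_space \<Rightarrow> ennreal"
  assumes [measurable]: "k \<in> borel_measurable borel" "v \<in> borel_measurable borel"
    "w \<in> borel_measurable borel"
  shows "nn_conv ((nn_conv k ^^ n) v) w = (nn_conv k ^^ n) (nn_conv v w)"
  by (induction n) (simp_all add: nn_conv_assoc)

section \<open>Mass and sup bounds for convolutions\<close>

lemma nn_integral_nn_conv:
  fixes k v :: "'a::euclidean_space \<Rightarrow> ennreal"
  assumes [measurable]: "k \<in> borel_measurable borel" "v \<in> borel_measurable borel"
  shows "(\<integral>\<^sup>+ x. nn_conv k v x \<partial>lborel) = (\<integral>\<^sup>+ x. k x \<partial>lborel) * (\<integral>\<^sup>+ x. v x \<partial>lborel)"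
proof -
  have "(\<integral>\<^sup>+ x. nn_conv k v x \<partial>lborel) = (\<integral>\<^sup>+ y. (\<integral>\<^sup>+ x. k (x - y) * v y \<partial>lborel) \<partial>lborel)"
    unfolding nn_conv_def by (rule lborel_pair.Fubini') measurable
  also have "\<dots> = (\<integral>\<^sup>+ y. (\<integral>\<^sup>+ x. k x \<partial>lborel) * v y \<partial>lborel)"
  proof (intro nn_integral_cong)
    fix y
    have "(\<integral>\<^sup>+ x. k (- y + x) \<partial>lborel) = (\<integral>\<^sup>+ x. k x \<partial>lborel)"
      by (rule nn_integral_lborel_translate) auto
    then show "(\<integral>\<^sup>+ x. k (x - y) * v y \<partial>lborel) = (\<integral>\<^sup>+ x. k x \<partial>lborel) * v y"
      by (simp add: nn_integral_multc)
  qed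
  finally show ?thesis
    by (simp add: nn_integral_cmult)
qed

lemma nn_conv_le_sup_left:
  fixes k v :: "'a::euclidean_space \<Rightarrow> ennreal"
  assumes [measurable]: "k \<in> borel_measurable borel" "v \<in> borel_measurable borel"
    and "\<And>y. k y \<le> c"
  shows "nn_conv k v x \<le> c * (\<integral>\<^sup>+ y. v y \<partial>lborel)"
proof -
  have "nn_conv k v x \<le> (\<integral>\<^sup>+ y. c * v y \<partial>lborel)"
    unfolding nn_conv_def by (intro nn_integral_mono mult_right_mono assms) auto
  then show ?thesis by (simp add: nn_integral_cmult)
qed

lemma nn_conv_le_sup_right:
  fixes k v :: "'a::euclidean_space \<Rightarrow> ennreal"
  assumes "k \<in> borel_measurable borel" "v \<in> borel_measurable borel" "\<And>y. v y \<le> c"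
  shows "nn_conv k v x \<le> (\<integral>\<^sup>+ y. k y \<partial>lborel) * c"
  using nn_conv_le_sup_left[of v k c x] nn_conv_commute[of k v] assms by (simp add: mult.commute)

lemma nn_conv_pow_le_sup:
  fixes k v :: "'a::euclidean_space \<Rightarrow> ennreal"
  assumes [measurable]: "k \<in> borel_measurable borel" "v \<in> borel_measurable borel"
    and "\<And>y. v y \<le> c"
  shows "(nn_conv k ^^ n) v x \<le> (\<integral>\<^sup>+ y. k y \<partial>lborel) ^ n * c"
proof (induction n arbitrary: x)
  case (Suc n)
  then show ?case
    using nn_conv_le_sup_right[of k "(nn_conv k ^^ n) v" "(\<integral>\<^sup>+ y. k y \<partial>lborel) ^ n * c" x]
    by (simp add: mult.assoc)
qed (simp add: assms)

lemma nn_integral_nn_conv_pow: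
  fixes k v :: "'a::euclidean_space \<Rightarrow> ennreal"
  assumes [measurable]: "k \<in> borel_measurable borel" "v \<in> borel_measurable borel"
  shows "(\<integral>\<^sup>+ x. (nn_conv k ^^ n) v x \<partial>lborel) = (\<integral>\<^sup>+ x. k x \<partial>lborel) ^ n * (\<integral>\<^sup>+ x. v x \<partial>lborel)"
  by (induction n) (simp_all add: nn_integral_nn_conv mult.assoc)

section \<open>Linearity of convolution in both arguments\<close>

lemma nn_conv_cmult_left:
  fixes k v :: "'a::euclidean_space \<Rightarrow> ennreal"
  assumes [measurable]: "k \<in> borel_measurable borel" "v \<in> borel_measurable borel"
  shows "nn_conv (\<lambda>x. c * k x) v = (\<lambda>x. c * nn_conv k v x)"
  by (simp add: fun_eq_iff nn_conv_def mult.assoc nn_integral_cmult)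

lemma nn_conv_cmult_right:
  fixes k v :: "'a::euclidean_space \<Rightarrow> ennreal"
  assumes [measurable]: "k \<in> borel_measurable borel" "v \<in> borel_measurable borel"
  shows "nn_conv k (\<lambda>x. c * v x) = (\<lambda>x. c * nn_conv k v x)"
  using nn_conv_cmult_left[of v k c] by (simp add: nn_conv_commute[of k])

lemma nn_conv_add_left:
  fixes k1 k2 v :: "'a::euclidean_space \<Rightarrow> ennreal"
  assumes [measurable]: "k1 \<in> borel_measurable borel" "k2 \<in> borel_measurable borel"
    "v \<in> borel_measurable borel"
  shows "nn_conv (\<lambda>x. k1 x + k2 x) v = (\<lambda>x. nn_conv k1 v x + nn_conv k2 v x)"
  by (simp add: fun_eq_iff nn_conv_def distrib_right nn_integral_add)

lemma nn_conv_sum_right: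
  fixes k :: "'a::euclidean_space \<Rightarrow> ennreal"
  assumes [measurable]: "k \<in> borel_measurable borel" "\<And>i. i \<in> I \<Longrightarrow> v i \<in> borel_measurable borel"
  shows "nn_conv k (\<lambda>x. \<Sum>i\<in>I. v i x) = (\<lambda>x. \<Sum>i\<in>I. nn_conv k (v i) x)"
  by (simp add: fun_eq_iff nn_conv_def sum_distrib_left nn_integral_sum)

lemma nn_conv_pow_cmult_left:
  fixes k v :: "'a::euclidean_space \<Rightarrow> ennreal"
  assumes [measurable]: "k \<in> borel_measurable borel" "v \<in> borel_measurable borel"
  shows "(nn_conv (\<lambda>x. c * k x) ^^ n) v = (\<lambda>x. c ^ n * (nn_conv k ^^ n) v x)"
  by (induction n) (simp_all add: nn_conv_cmult_left nn_conv_cmult_right mult.assoc)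

lemma nn_conv_pow_lincomb_right:
  fixes k :: "'a::euclidean_space \<Rightarrow> ennreal"
  assumes [measurable]: "k \<in> borel_measurable borel" "\<And>i. i \<in> I \<Longrightarrow> v i \<in> borel_measurable borel"
  shows "(nn_conv k ^^ n) (\<lambda>x. \<Sum>i\<in>I. c i * v i x) = (\<lambda>x. \<Sum>i\<in>I. c i * (nn_conv k ^^ n) (v i) x)"
  by (induction n) (simp_all add: nn_conv_sum_right nn_conv_cmult_right)

section \<open>Lattice densities\<close>

text \<open>The probability of k heads in j fair tosses. The index is an integer, with value 0 at
  negative ones, because it will be a floor and because Pascal's rule then has no boundary
  case.\<close>

definition binomial_weight :: "nat \<Rightarrow> int \<Rightarrow> real" where
  "binomial_weight j k = (if k < 0 then 0 else real (j choose nat k) / 2 ^ j)"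

lemma binomial_weight_nonneg: "0 \<le> binomial_weight j k"
  by (simp add: binomial_weight_def)

lemma binomial_weight_Suc:
  "binomial_weight (Suc j) k = (binomial_weight j k + binomial_weight j (k - 1)) / 2"
proof (cases "k \<le> 0")
  case True
  then show ?thesis
    by (cases "k = 0") (simp_all add: binomial_weight_def)
next
  case False
  define m where "m = nat (k - 1)"
  have "k = int (Suc m)"
    using False by (simp add: m_def)
  then show ?thesis
    by (simp add: binomial_weight_def nat_add_distrib field_simps)
qed

text \<open>Passing from m to m + 1 multiplies a = C(2m,m) / 4^m by (2m+1)/(2m+2), and (2m+1)(2m+3)
  \<le> (2m+2)^2. So a^2 (2m+1) does not increase from its value 1 at m = 0.\<close>

lemma central_binomial_sq_le: "(real ((2 * m) choose m) / 4 ^ m)\<^sup>2 * (2 * real m + 1) \<le> 1"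
proof (induction m)
  case (Suc m)
  define a where "a = real ((2 * m) choose m) / 4 ^ m"
  \<comment> \<open>Two applications of the absorption identity (k+1) C(n+1,k+1) = (n+1) C(n,k),
    with the symmetry C(2m+1,m) = C(2m+1,m+1) in between.\<close>
  have step: "real (Suc m) * real ((2 * Suc m) choose (Suc m)) = 2 * (2 * real m + 1) * real ((2 * m) choose m)"
  proof -
    have "Suc m * ((2 * Suc m) choose (Suc m)) = (2 * Suc m) * ((2 * m + 1) choose m)"
      using Suc_times_binomial_eq[of "2 * m + 1" m] by (simp add: mult.commute)
    moreover have "(2 * m + 1) choose m = ((2 * m + 1) choose (m + 1))"
      by (subst binomial_symmetric) auto
    moreover have "Suc m * ((2 * m + 1) choose (Suc m)) = (2 * m + 1) * ((2 * m) choose m)"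
      using Suc_times_binomial_eq[of "2 * m" m] by (simp add: mult.commute)
    ultimately have "Suc m * ((2 * Suc m) choose (Suc m)) = 2 * ((2 * m + 1) * ((2 * m) choose m))"
      by (metis Suc_eq_plus1 mult.assoc)
    then have "real (Suc m * ((2 * Suc m) choose (Suc m))) = real (2 * ((2 * m + 1) * ((2 * m) choose m)))"
      by presburger
    then show ?thesis
      by (simp only: of_nat_mult of_nat_add of_nat_numeral of_nat_1 mult.assoc)
  qed
  have "real ((2 * Suc m) choose (Suc m)) / 4 ^ Suc m = a * (2 * real m + 1) / (2 * real m + 2)"
  proof -
    have c: "real ((2 * Suc m) choose (Suc m)) = 2 * (2 * real m + 1) * real ((2 * m) choose m) / real (Suc m)"
      using step by (simp add: eq_divide_eq mult.commute del: of_nat_Suc binomial_Suc_Suc)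
    show ?thesis
      unfolding c by (simp add: a_def divide_simps) (simp add: algebra_simps)
  qed
  moreover have "(a * (2 * real m + 1) / (2 * real m + 2))\<^sup>2 * (2 * real (Suc m) + 1)
     = (a\<^sup>2 * (2 * real m + 1)) * ((2 * real m + 1) * (2 * real m + 3) / (2 * real m + 2)\<^sup>2)"
    by (simp add: power2_eq_square field_simps)
  moreover have "\<dots> \<le> 1 * 1"
  proof (rule mult_mono)
    have "(2 * real m + 1) * (2 * real m + 3) \<le> (2 * real m + 2)\<^sup>2"
      by (simp add: power2_eq_square algebra_simps)
    then show "(2 * real m + 1) * (2 * real m + 3) / (2 * real m + 2)\<^sup>2 \<le> 1"
      by (simp add: divide_le_eq)
  qed (use Suc.IH in \<open>auto simp: a_def\<close>)
  ultimately show ?case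
    by simp
qed simp

text \<open>The central coefficient is the largest of its row, which settles even j by
  \<open>central_binomial_sq_le\<close>; odd rows are reduced to even ones.\<close>

lemma binomial_weight_sq_le: "(binomial_weight j k)\<^sup>2 * (real j + 1) \<le> 1"
proof -
  have even: "(real ((2 * m) choose i) / 2 ^ (2 * m))\<^sup>2 * (2 * real m + 1) \<le> 1" for m i
  proof -
    have "(real ((2 * m) choose i) / 2 ^ (2 * m))\<^sup>2 \<le> (real ((2 * m) choose m) / 4 ^ m)\<^sup>2"
      using binomial_maximum'[of m i] by (intro power_mono) (simp_all add: power_mult divide_right_mono)
    then have "(real ((2 * m) choose i) / 2 ^ (2 * m))\<^sup>2 * (2 * real m + 1)
        \<le> (real ((2 * m) choose m) / 4 ^ m)\<^sup>2 * (2 * real m + 1)"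
      by (rule mult_right_mono) simp
    also have "\<dots> \<le> 1" by (rule central_binomial_sq_le)
    finally show ?thesis .
  qed
  have main: "(real (j choose i) / 2 ^ j)\<^sup>2 * (real j + 1) \<le> 1" for i
  proof (cases "even j")
    case True
    then obtain m where "j = 2 * m" by blast
    then show ?thesis using even[of m i] by simp
  next
    case False
    then obtain m where j: "j = 2 * m + 1" by (auto elim: oddE)
    \<comment> \<open>As C(2m+2,m+1) = 2 C(2m+1,m), every weight of the odd row j is at most the
      central weight of the even row j + 1.\<close>
    have "2 * (j choose i) \<le> ((2 * (m + 1)) choose (m + 1))"
    proof -
      have "(j choose i) \<le> (j choose m)"
        using binomial_maximum[of j i] by (simp add: j)
      moreover have "((2 * (m + 1)) choose (m + 1)) = 2 * (j choose m)"
      proof -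
        have "((2 * (m + 1)) choose (m + 1)) = (j choose m) + (j choose (m + 1))"
          by (simp add: j)
        also have "(j choose (m + 1)) = (j choose m)"
          unfolding j by (subst binomial_symmetric) auto
        finally show ?thesis by simp
      qed
      ultimately show ?thesis by simp
    qed
    then have "real (2 * (j choose i)) \<le> real ((2 * (m + 1)) choose (m + 1))"
      by (rule of_nat_mono)
    then have "real (j choose i) / 2 ^ j \<le> real ((2 * (m + 1)) choose (m + 1)) / 4 ^ (m + 1)"
    proof -
      have "(2::real) ^ j = 2 * 4 ^ m" by (simp add: j power_mult)
      then show ?thesis
        using \<open>real (2 * (j choose i)) \<le> real ((2 * (m + 1)) choose (m + 1))\<close>
        by (simp add: field_simps del: binomial_Suc_Suc mult_Suc_right)
    qed
    then have "(real (j choose i) / 2 ^ j)\<^sup>2 \<le> (real ((2 * (m + 1)) choose (m + 1)) / 4 ^ (m + 1))\<^sup>2"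
      by (intro power_mono) auto
    then have "(real (j choose i) / 2 ^ j)\<^sup>2 * (real j + 1)
       \<le> (real ((2 * (m + 1)) choose (m + 1)) / 4 ^ (m + 1))\<^sup>2 * (2 * real (m + 1) + 1)"
      by (intro mult_mono) (auto simp: j)
    also have "\<dots> \<le> 1" by (rule central_binomial_sq_le)
    finally show ?thesis .
  qed
  show ?thesis
    using main by (auto simp: binomial_weight_def)
qed

text \<open>For h > 0 this is h^N times the density of a uniform point of [0,h)^N plus h times a sum
  of j independent uniform vertices of {0,1}^N. For j = 0 it is the indicator of [0,h)^N, for j = 1
  it is 2^(-N) times that of [0,2h)^N.\<close>

definition lattice_density :: "real \<Rightarrow> nat \<Rightarrow> 'a::euclidean_space \<Rightarrow> ennreal" where
  "lattice_density h j x = (\<Prod>b\<in>Basis. ennreal (binomial_weight j \<lfloor>x \<bullet> b / h\<rfloor>))"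

lemma lattice_density_measurable [measurable]:
  "(lattice_density h j :: 'a::euclidean_space \<Rightarrow> ennreal) \<in> borel_measurable borel"
  unfolding lattice_density_def[abs_def] by measurable

text \<open>Pascal's rule in every coordinate; expanding the product of two-term sums gives a sum
  over subsets of \<open>Basis\<close>, and a subset \<open>\<sigma>\<close> stands for the vertex
  \<open>\<Sum>\<sigma>\<close> of the unit cube.\<close>

lemma lattice_density_Suc:
  fixes x :: "'a::euclidean_space"
  assumes "h > 0"
  shows "lattice_density h (Suc j) x
    = (\<Sum>\<sigma>\<in>Pow Basis. ennreal ((1/2) ^ DIM('a)) * lattice_density h j (x - h *\<^sub>R \<Sum>\<sigma>))"
proof -
  define w where "w b i = binomial_weight j (\<lfloor>x \<bullet> b / h\<rfloor> - i)" for b :: 'a and i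
  \<comment> \<open>By orthonormality of the basis, subtracting the vertex lowers the cell index by
    one exactly in the coordinates belonging to \<open>\<sigma>\<close>.\<close>
  have floor: "\<lfloor>(x - h *\<^sub>R \<Sum>\<sigma>) \<bullet> b / h\<rfloor> = \<lfloor>x \<bullet> b / h\<rfloor> - (if b \<in> \<sigma> then 1 else 0)"
    if "\<sigma> \<subseteq> Basis" "b \<in> Basis" for \<sigma> and b :: 'a
  proof -
    have "finite \<sigma>"
      using that by (meson finite_Basis finite_subset)
    have "\<Sum>\<sigma> \<bullet> b = (\<Sum>c\<in>\<sigma>. if c = b then 1 else 0)"
      unfolding inner_sum_left using that by (intro sum.cong) (auto simp: inner_Basis)
    also have "\<dots> = (if b \<in> \<sigma> then 1 else 0)"
      using \<open>finite \<sigma>\<close> by simp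
    finally have "(x - h *\<^sub>R \<Sum>\<sigma>) \<bullet> b / h = x \<bullet> b / h - of_int (if b \<in> \<sigma> then 1 else 0)"
      using assms by (auto simp: inner_diff_left diff_divide_distrib)
    then show ?thesis by simp
  qed
  have "lattice_density h (Suc j) x = ennreal (\<Prod>b\<in>Basis. (1/2) * (w b 1 + w b 0))"
    unfolding lattice_density_def binomial_weight_Suc w_def
    by (subst prod_ennreal) (auto simp: binomial_weight_nonneg add.commute)
  also have "(\<Prod>b\<in>Basis. (1/2) * (w b 1 + w b 0)) = (1/2) ^ DIM('a) * (\<Prod>b\<in>Basis. w b 1 + w b 0)"
    by (subst prod.distrib) (simp add: power_one_over)
  also have "(\<Prod>b\<in>Basis. w b 1 + w b 0)
      = (\<Sum>\<sigma>\<in>Pow Basis. (\<Prod>b\<in>\<sigma>. w b 1) * (\<Prod>b\<in>Basis - \<sigma>. w b 0))"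
    by (rule prod_add) simp
  also have "\<dots> = (\<Sum>\<sigma>\<in>Pow Basis. \<Prod>b\<in>Basis. w b (if b \<in> \<sigma> then 1 else 0))"
  proof (intro sum.cong refl)
    fix \<sigma> :: "'a set" assume "\<sigma> \<in> Pow Basis"
    then have "\<sigma> \<subseteq> Basis" by auto
    then have "(\<Prod>b\<in>Basis. w b (if b \<in> \<sigma> then 1 else 0))
      = (\<Prod>b\<in>\<sigma>. w b (if b \<in> \<sigma> then 1 else 0)) * (\<Prod>b\<in>Basis - \<sigma>. w b (if b \<in> \<sigma> then 1 else 0))"
      by (subst prod.subset_diff[OF \<open>\<sigma> \<subseteq> Basis\<close> finite_Basis]) (rule mult.commute)
    then show "(\<Prod>b\<in>\<sigma>. w b 1) * (\<Prod>b\<in>Basis - \<sigma>. w b 0) = (\<Prod>b\<in>Basis. w b (if b \<in> \<sigma> then 1 else 0))"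
      by simp
  qed
  also have "(1/2) ^ DIM('a) * \<dots> = (\<Sum>\<sigma>\<in>Pow Basis. (1/2) ^ DIM('a) * (\<Prod>b\<in>Basis. w b (if b \<in> \<sigma> then 1 else 0)))"
    by (rule sum_distrib_left)
  also have "ennreal \<dots> = (\<Sum>\<sigma>\<in>Pow Basis. ennreal ((1/2) ^ DIM('a) * (\<Prod>b\<in>Basis. w b (if b \<in> \<sigma> then 1 else 0))))"
    by (rule sum_ennreal[symmetric]) (auto simp: w_def binomial_weight_nonneg prod_nonneg)
  also have "\<dots> = (\<Sum>\<sigma>\<in>Pow Basis. ennreal ((1/2) ^ DIM('a)) * lattice_density h j (x - h *\<^sub>R \<Sum>\<sigma>))"
  proof (intro sum.cong refl)
    fix \<sigma> :: "'a set" assume "\<sigma> \<in> Pow Basis"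
    then have "lattice_density h j (x - h *\<^sub>R \<Sum>\<sigma>) = (\<Prod>b\<in>Basis. ennreal (w b (if b \<in> \<sigma> then 1 else 0)))"
      unfolding lattice_density_def w_def by (intro prod.cong refl) (subst floor, auto)
    also have "\<dots> = ennreal (\<Prod>b\<in>Basis. w b (if b \<in> \<sigma> then 1 else 0))"
      by (subst prod_ennreal) (auto simp: w_def binomial_weight_nonneg)
    finally show "ennreal ((1/2) ^ DIM('a) * (\<Prod>b\<in>Basis. w b (if b \<in> \<sigma> then 1 else 0)))
      = ennreal ((1/2) ^ DIM('a)) * lattice_density h j (x - h *\<^sub>R \<Sum>\<sigma>)"
      by (simp add: ennreal_mult w_def binomial_weight_nonneg prod_nonneg)
  qed
  finally show ?thesis .
qed

lemma prod_mono_ennreal: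
  fixes f g :: "'a \<Rightarrow> ennreal"
  assumes "\<And>x. x \<in> A \<Longrightarrow> f x \<le> g x"
  shows "prod f A \<le> prod g A"
  using assms by (induction A rule: infinite_finite_induct) (auto intro: mult_mono)

lemma nn_conv_translate:
  fixes k v :: "'a::euclidean_space \<Rightarrow> ennreal"
  assumes [measurable]: "k \<in> borel_measurable borel" "v \<in> borel_measurable borel"
  shows "nn_conv (\<lambda>x. k (x - a)) v x = nn_conv k (\<lambda>x. v (x - a)) x"
proof -
  have "(\<integral>\<^sup>+ y. k (x - y - a) * v y \<partial>lborel)
      = (\<integral>\<^sup>+ y. k (x - (- a + y) - a) * v (- a + y) \<partial>lborel)"
    by (rule nn_integral_lborel_translate[symmetric]) auto
  then show ?thesis
    by (simp add: nn_conv_def algebra_simps)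
qed

text \<open>The densities with indices 1 and \<open>Suc j\<close> are the same average of
  translates, of those with indices 0 and \<open>j\<close>; a translation can be moved from one
  factor of a convolution to the other.\<close>

lemma nn_conv_lattice_density:
  assumes "h > 0"
  shows "nn_conv (lattice_density h 1) (lattice_density h j)
    = nn_conv (lattice_density h 0) (lattice_density h (Suc j) :: 'a::euclidean_space \<Rightarrow> ennreal)"
proof
  fix x :: 'a
  let ?c = "ennreal ((1/2) ^ DIM('a))"
  let ?q = "lattice_density h :: nat \<Rightarrow> 'a \<Rightarrow> ennreal"
  have q1: "?q (Suc i) = (\<lambda>x. \<Sum>\<sigma>\<in>Pow Basis. ?c * ?q i (x - h *\<^sub>R \<Sum>\<sigma>))" for i
    by (rule ext) (rule lattice_density_Suc[OF assms])
  have "nn_conv (?q j) (?q (Suc 0)) x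
      = (\<Sum>\<sigma>\<in>Pow Basis. ?c * nn_conv (?q j) (\<lambda>x. ?q 0 (x - h *\<^sub>R \<Sum>\<sigma>)) x)"
    by (subst q1, subst nn_conv_sum_right) (simp_all add: nn_conv_cmult_right)
  also have "\<dots> = (\<Sum>\<sigma>\<in>Pow Basis. ?c * nn_conv (?q 0) (\<lambda>x. ?q j (x - h *\<^sub>R \<Sum>\<sigma>)) x)"
    by (subst nn_conv_commute) (simp_all add: nn_conv_translate)
  also have "\<dots> = nn_conv (?q 0) (?q (Suc j)) x"
    by (subst q1, subst nn_conv_sum_right) (simp_all add: nn_conv_cmult_right)
  finally show "nn_conv (?q 1) (?q j) x = nn_conv (?q 0) (?q (Suc j)) x"
    by (simp add: nn_conv_commute[of "?q j"])
qed

text \<open>Splits a power of the box of side 2h into a power of the box of side h, which only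
  averages, and one lattice density, which carries all the decay.\<close>

lemma nn_conv_pow_lattice_density:
  assumes "h > 0"
  shows "(nn_conv (lattice_density h 1) ^^ j) (lattice_density h 1)
    = (nn_conv (lattice_density h 0) ^^ j) (lattice_density h (Suc j) :: 'a::euclidean_space \<Rightarrow> ennreal)"
proof (induction j)
  case (Suc j)
  let ?q = "lattice_density h :: nat \<Rightarrow> 'a \<Rightarrow> ennreal"
  have "(nn_conv (?q 1) ^^ Suc j) (?q 1) = nn_conv (?q 1) ((nn_conv (?q 0) ^^ j) (?q (Suc j)))"
    using Suc.IH by simp
  also have "\<dots> = (nn_conv (?q 0) ^^ j) (nn_conv (?q 1) (?q (Suc j)))"
    by (rule nn_conv_pow_commute) auto
  also have "\<dots> = (nn_conv (?q 0) ^^ Suc j) (?q (Suc (Suc j)))"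
    unfolding nn_conv_lattice_density[OF assms] by (simp only: funpow_Suc_right comp_apply)
  finally show ?case .
qed simp

lemma nn_integral_lattice_density:
  assumes "h > 0" "j \<le> 1"
  shows "(\<integral>\<^sup>+ x. lattice_density h j (x :: 'a::euclidean_space) \<partial>lborel) = ennreal (h ^ DIM('a))"
proof -
  \<comment> \<open>For \<open>j \<le> 1\<close> all nonzero weights agree: they equal 2^(-j), on
    the interval [0, 2^j h).\<close>
  have *: "binomial_weight j \<lfloor>s / h\<rfloor> = (1/2) ^ j * indicator {0..<2 ^ j * h} s" for s
  proof -
    have "(\<lfloor>s / h\<rfloor> < 0 \<longleftrightarrow> s < 0) \<and> (\<lfloor>s / h\<rfloor> < 1 \<longleftrightarrow> s < h) \<and> (\<lfloor>s / h\<rfloor> < 2 \<longleftrightarrow> s < 2 * h)"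
      using assms(1) by (auto simp: floor_less_iff divide_less_eq)
    moreover have "j = 0 \<or> j = 1" using assms(2) by auto
    moreover have "(0 choose nat \<lfloor>s / h\<rfloor>) = 0" if "\<lfloor>s / h\<rfloor> \<ge> 1"
      using that by (intro binomial_eq_0) auto
    moreover have "(Suc 0 choose nat \<lfloor>s / h\<rfloor>) = 0" if "\<lfloor>s / h\<rfloor> \<ge> 2"
      using that by (intro binomial_eq_0) auto
    moreover have "\<lfloor>s / h\<rfloor> = 0 \<or> \<lfloor>s / h\<rfloor> = 1" if "0 \<le> \<lfloor>s / h\<rfloor>" "\<lfloor>s / h\<rfloor> < 2"
      using that by linarith
    ultimately show ?thesis
      by (auto simp: binomial_weight_def indicator_def split: if_splits)
  qed
  have "(\<integral>\<^sup>+ s. ennreal (binomial_weight j \<lfloor>s / h\<rfloor>) \<partial>lborel) = ennreal h"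
  proof -
    have "(\<integral>\<^sup>+ s. ennreal (binomial_weight j \<lfloor>s / h\<rfloor>) \<partial>lborel)
      = (\<integral>\<^sup>+ s. ennreal ((1/2) ^ j) * indicator {0..<2 ^ j * h} s \<partial>lborel)"
      unfolding * by (intro nn_integral_cong) (auto simp: indicator_def)
    also have "\<dots> = ennreal ((1/2) ^ j) * ennreal (2 ^ j * h)"
      using assms(1) by (subst nn_integral_cmult_indicator) auto
    also have "\<dots> = ennreal h"
      using assms(1) by (simp add: ennreal_mult[symmetric] power_one_over)
    finally show ?thesis .
  qed
  moreover have "(\<integral>\<^sup>+ x. lattice_density h j (x :: 'a) \<partial>lborel)
     = (\<Prod>b\<in>(Basis :: 'a set). \<integral>\<^sup>+ s. ennreal (binomial_weight j \<lfloor>s / h\<rfloor>) \<partial>lborel)"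
    unfolding lattice_density_def by (rule nn_integral_lborel_prod) auto
  ultimately show ?thesis
    using assms(1) by (simp add: ennreal_power)
qed

lemma lattice_density_1_eq_0:
  fixes x :: "'a::euclidean_space"
  assumes "h > 0" "b \<in> Basis" "x \<bullet> b < 0 \<or> 2 * h \<le> x \<bullet> b"
  shows "lattice_density h 1 x = 0"
proof -
  have "\<lfloor>x \<bullet> b / h\<rfloor> < 0 \<or> 2 \<le> \<lfloor>x \<bullet> b / h\<rfloor>"
    using assms(1,3) by (auto simp: floor_less_iff le_floor_iff divide_less_eq le_divide_eq)
  then have "binomial_weight 1 \<lfloor>x \<bullet> b / h\<rfloor> = 0"
    by (auto simp: binomial_weight_def binomial_eq_0)
  then have "ennreal (binomial_weight 1 \<lfloor>x \<bullet> b / h\<rfloor>) = 0"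
    by (simp only: ennreal_0)
  then show ?thesis
    unfolding lattice_density_def using assms(2) by (intro prod_zero) auto
qed

text \<open>The one-dimensional bound, multiplied over the coordinates. The square keeps the decay
  (j + 1)^(-N/2) in integer powers.\<close>

lemma lattice_density_sq_le:
  "(lattice_density h j (x :: 'a::euclidean_space))\<^sup>2 * ennreal ((real j + 1) ^ DIM('a)) \<le> 1"
proof -
  have "(lattice_density h j x)\<^sup>2 * ennreal ((real j + 1) ^ DIM('a))
     = (\<Prod>b\<in>Basis. ennreal ((binomial_weight j \<lfloor>x \<bullet> b / h\<rfloor>)\<^sup>2 * (real j + 1)))"
    unfolding lattice_density_def
    by (simp add: prod.distrib ennreal_mult binomial_weight_nonneg ennreal_power[symmetric] prod_power_distrib)
  also have "\<dots> \<le> (\<Prod>b\<in>(Basis :: 'a set). 1)"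
    by (rule prod_mono_ennreal) (simp add: binomial_weight_sq_le ennreal_le_1)
  finally show ?thesis by simp
qed

section \<open>Exponential series of a kernel that dominates a box\<close>

text \<open>A truncated exponential of the convolution operator. Finite sums avoid limits in
  \<open>ennreal\<close>: the bounds on them are uniform in \<open>m\<close>, and a limit is taken
  only when the solution is compared with them.\<close>

definition exp_sum ::
  "nat \<Rightarrow> real \<Rightarrow> ('a::euclidean_space \<Rightarrow> ennreal) \<Rightarrow> ('a \<Rightarrow> ennreal) \<Rightarrow> 'a \<Rightarrow> ennreal" where
  "exp_sum m t k w x = (\<Sum>n<m. ennreal (t ^ n / fact n) * (nn_conv k ^^ n) w x)"

lemma exp_sum_measurable [measurable]:
  assumes [measurable]: "k \<in> borel_measurable borel" "w \<in> borel_measurable borel"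
  shows "exp_sum m t k w \<in> borel_measurable borel"
  unfolding exp_sum_def[abs_def] by measurable

text \<open>Pascal's rule in the form needed for the binomial theorem; \<open>F j i\<close> stands
  for j factors of the first kind and i of the second.\<close>

lemma binomial_convolution_step:
  fixes F :: "nat \<Rightarrow> nat \<Rightarrow> ennreal"
  shows "(\<Sum>j\<le>n. of_nat (n choose j) * (F (Suc j) (n - j) + F j (Suc (n - j))))
    = (\<Sum>j\<le>Suc n. of_nat (Suc n choose j) * F j (Suc n - j))"
proof -
  have "(\<Sum>j\<le>Suc n. of_nat (Suc n choose j) * F j (Suc n - j))
      = F 0 (Suc n) + (\<Sum>j\<le>n. of_nat (n choose Suc j) * F (Suc j) (n - j))
        + (\<Sum>j\<le>n. of_nat (n choose j) * F (Suc j) (n - j))"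
  proof -
    have "(\<Sum>j\<le>Suc n. of_nat (Suc n choose j) * F j (Suc n - j))
        = F 0 (Suc n) + (\<Sum>j\<le>n. of_nat (n choose Suc j) * F (Suc j) (n - j) + of_nat (n choose j) * F (Suc j) (n - j))"
      by (subst sum.atMost_Suc_shift) (simp add: distrib_right add.commute)
    then show ?thesis
      by (simp only: sum.distrib add.assoc)
  qed
  also have "F 0 (Suc n) + (\<Sum>j\<le>n. of_nat (n choose Suc j) * F (Suc j) (n - j))
      = (\<Sum>j\<le>Suc n. of_nat (n choose j) * F j (Suc n - j))"
    by (subst sum.atMost_Suc_shift) simp
  \<comment> \<open>The last term of the longer sum drops out because \<open>n choose Suc n\<close>
    is 0.\<close>
  also have "\<dots> = (\<Sum>j\<le>n. of_nat (n choose j) * F j (Suc (n - j)))"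
    by (simp add: binomial_eq_0 Suc_diff_le)
  finally show ?thesis
    by (simp only: distrib_left sum.distrib add.commute)
qed

text \<open>The binomial theorem, valid because convolution operators commute.\<close>

lemma nn_conv_pow_add_left:
  fixes k1 k2 w :: "'a::euclidean_space \<Rightarrow> ennreal"
  assumes [measurable]: "k1 \<in> borel_measurable borel" "k2 \<in> borel_measurable borel"
    "w \<in> borel_measurable borel"
  shows "(nn_conv (\<lambda>x. k1 x + k2 x) ^^ n) w
    = (\<lambda>x. \<Sum>j\<le>n. of_nat (n choose j) * (nn_conv k1 ^^ j) ((nn_conv k2 ^^ (n - j)) w) x)"
proof (induction n)
  case (Suc n)
  define F where "F j i = (nn_conv k1 ^^ j) ((nn_conv k2 ^^ i) w)" for j i
  have [measurable]: "F j i \<in> borel_measurable borel" for j i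
    unfolding F_def by measurable
  have F1: "nn_conv k1 (F j i) = F (Suc j) i" for j i
    by (simp add: F_def)
  have F2: "nn_conv k2 (F j i) = F j (Suc i)" for j i
    by (simp add: F_def nn_conv_pow_commute)
  have "(nn_conv (\<lambda>x. k1 x + k2 x) ^^ Suc n) w
      = nn_conv (\<lambda>x. k1 x + k2 x) (\<lambda>x. \<Sum>j\<le>n. of_nat (n choose j) * F j (n - j) x)"
    by (simp add: Suc.IH F_def)
  also have "\<dots> = (\<lambda>x. \<Sum>j\<le>n. of_nat (n choose j) * (F (Suc j) (n - j) x + F j (Suc (n - j)) x))"
    by (subst nn_conv_sum_right)
       (simp_all add: nn_conv_cmult_right nn_conv_add_left F1 F2)
  also have "\<dots> = (\<lambda>x. \<Sum>j\<le>Suc n. of_nat (Suc n choose j) * F j (Suc n - j) x)"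
    by (rule ext) (rule binomial_convolution_step)
  finally show ?case
    unfolding F_def .
qed simp

text \<open>The truncated form of exp(k1 + k2) = exp(k1) exp(k2): the terms on the left are indexed
  by the triangle j + i < m, those on the right by the square containing it, and all are
  nonnegative.\<close>

lemma exp_sum_add_le:
  fixes k1 k2 w :: "'a::euclidean_space \<Rightarrow> ennreal"
  assumes [measurable]: "k1 \<in> borel_measurable borel" "k2 \<in> borel_measurable borel"
    "w \<in> borel_measurable borel"
    and "0 \<le> t"
  shows "exp_sum m t (\<lambda>x. k1 x + k2 x) w x \<le> exp_sum m t k1 (exp_sum m t k2 w) x"
proof -
  define F where "F j i = ennreal (t ^ j / fact j) * (ennreal (t ^ i / fact i) * (nn_conv k1 ^^ j) ((nn_conv k2 ^^ i) w) x)" for j i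
  have "exp_sum m t (\<lambda>x. k1 x + k2 x) w x = (\<Sum>n<m. \<Sum>j\<le>n. F j (n - j))"
    unfolding exp_sum_def nn_conv_pow_add_left[OF assms(1-3)] sum_distrib_left
  proof (intro sum.cong refl)
    fix n j :: nat assume "j \<in> {..n}"
    then have "j \<le> n" by simp
    have "t ^ n / fact n * real (n choose j) = t ^ j / fact j * (t ^ (n - j) / fact (n - j))"
      using \<open>j \<le> n\<close> by (simp add: binomial_fact power_add[symmetric])
    then have "ennreal (t ^ n / fact n) * of_nat (n choose j) = ennreal (t ^ j / fact j) * ennreal (t ^ (n - j) / fact (n - j))"
      using assms(4) by (simp add: ennreal_of_nat_eq_real_of_nat ennreal_mult[symmetric])
    then show "ennreal (t ^ n / fact n) * (of_nat (n choose j) * (nn_conv k1 ^^ j) ((nn_conv k2 ^^ (n - j)) w) x)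
      = F j (n - j)"
      unfolding F_def by (simp only: mult.assoc[symmetric])
  qed
  also have "\<dots> = (\<Sum>(j, i)\<in>{(j, i). j + i < m}. F j i)"
    by (rule sum.triangle_reindex[symmetric])
  also have "\<dots> \<le> (\<Sum>(j, i)\<in>{..<m} \<times> {..<m}. F j i)"
    by (rule sum_mono2) auto
  also have "\<dots> = (\<Sum>j<m. \<Sum>i<m. F j i)"
    by (rule sum.cartesian_product[symmetric])
  also have "\<dots> = exp_sum m t k1 (exp_sum m t k2 w) x"
    unfolding exp_sum_def[abs_def] F_def
    by (subst nn_conv_pow_lincomb_right) (auto simp: sum_distrib_left)
  finally show ?thesis .
qed

lemma exp_sum_cmult_kernel:
  fixes k w :: "'a::euclidean_space \<Rightarrow> ennreal"
  assumes [measurable]: "k \<in> borel_measurable borel" "w \<in> borel_measurable borel"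
    and "0 \<le> t" "0 \<le> c"
  shows "exp_sum m t (\<lambda>x. ennreal c * k x) w = exp_sum m (c * t) k w"
proof
  fix x
  have "ennreal (t ^ n / fact n) * ennreal c ^ n = ennreal ((c * t) ^ n / fact n)" for n
    using assms(3,4) by (simp add: ennreal_power ennreal_mult[symmetric] power_mult_distrib mult.commute)
  then show "exp_sum m t (\<lambda>x. ennreal c * k x) w x = exp_sum m (c * t) k w x"
    unfolding exp_sum_def nn_conv_pow_cmult_left[OF assms(1,2)] by (simp only: mult.assoc[symmetric])
qed

section \<open>Growth of the exponential series in sup norm and in mass\<close>

lemma sum_le_exp:
  fixes s :: real
  assumes "0 \<le> s"
  shows "(\<Sum>n<m. s ^ n / fact n) \<le> exp s"
proof -
  have "(\<Sum>n<m. s ^ n /\<^sub>R fact n) \<le> (\<Sum>n. s ^ n /\<^sub>R fact n)"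
    using assms by (intro sum_le_suminf summable_exp_generic) auto
  then show ?thesis
    by (simp add: exp_def divide_inverse mult.commute)
qed

lemma ennreal_sum_le_exp:
  assumes "0 \<le> t" "0 \<le> c" "I \<le> ennreal c"
  shows "(\<Sum>n<m. ennreal (t ^ n / fact n) * I ^ n) \<le> ennreal (exp (t * c))"
proof -
  have "(\<Sum>n<m. ennreal (t ^ n / fact n) * I ^ n) \<le> (\<Sum>n<m. ennreal (t ^ n / fact n) * ennreal c ^ n)"
    by (intro sum_mono mult_left_mono power_mono assms) auto
  also have "\<dots> = (\<Sum>n<m. ennreal ((t * c) ^ n / fact n))"
    using assms by (intro sum.cong refl) (simp add: ennreal_power ennreal_mult[symmetric] power_mult_distrib)
  also have "\<dots> = ennreal (\<Sum>n<m. (t * c) ^ n / fact n)"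
    using assms by (intro sum_ennreal) auto
  also have "\<dots> \<le> ennreal (exp (t * c))"
    using assms by (intro ennreal_leI sum_le_exp) auto
  finally show ?thesis .
qed

lemma exp_sum_le_sup:
  fixes k w :: "'a::euclidean_space \<Rightarrow> ennreal"
  assumes [measurable]: "k \<in> borel_measurable borel" "w \<in> borel_measurable borel"
    and "\<And>y. w y \<le> V" "0 \<le> t" "0 \<le> c" "(\<integral>\<^sup>+ y. k y \<partial>lborel) \<le> ennreal c"
  shows "exp_sum m t k w x \<le> ennreal (exp (t * c)) * V"
proof -
  have "exp_sum m t k w x \<le> (\<Sum>n<m. ennreal (t ^ n / fact n) * ((\<integral>\<^sup>+ y. k y \<partial>lborel) ^ n * V))"
    unfolding exp_sum_def by (intro sum_mono mult_left_mono nn_conv_pow_le_sup assms) auto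
  also have "\<dots> = (\<Sum>n<m. ennreal (t ^ n / fact n) * (\<integral>\<^sup>+ y. k y \<partial>lborel) ^ n) * V"
    by (simp add: sum_distrib_right mult.assoc)
  also have "\<dots> \<le> ennreal (exp (t * c)) * V"
    by (intro mult_right_mono ennreal_sum_le_exp assms) auto
  finally show ?thesis .
qed

lemma nn_integral_exp_sum_le:
  fixes k w :: "'a::euclidean_space \<Rightarrow> ennreal"
  assumes [measurable]: "k \<in> borel_measurable borel" "w \<in> borel_measurable borel"
    and "0 \<le> t" "0 \<le> c" "(\<integral>\<^sup>+ y. k y \<partial>lborel) \<le> ennreal c"
  shows "(\<integral>\<^sup>+ x. exp_sum m t k w x \<partial>lborel) \<le> ennreal (exp (t * c)) * (\<integral>\<^sup>+ x. w x \<partial>lborel)"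
proof -
  have "(\<integral>\<^sup>+ x. exp_sum m t k w x \<partial>lborel)
      = (\<Sum>n<m. ennreal (t ^ n / fact n) * (\<integral>\<^sup>+ y. k y \<partial>lborel) ^ n) * (\<integral>\<^sup>+ x. w x \<partial>lborel)"
    unfolding exp_sum_def
    by (simp add: nn_integral_sum nn_integral_cmult nn_integral_nn_conv_pow sum_distrib_right mult.assoc)
  also have "\<dots> \<le> ennreal (exp (t * c)) * (\<integral>\<^sup>+ x. w x \<partial>lborel)"
    by (intro mult_right_mono ennreal_sum_le_exp assms) auto
  finally show ?thesis .
qed

lemma nn_conv_translate_right:
  fixes k v :: "'a::euclidean_space \<Rightarrow> ennreal"
  assumes [measurable]: "k \<in> borel_measurable borel" "v \<in> borel_measurable borel"
  shows "nn_conv k (\<lambda>x. v (x - a)) x = nn_conv k v (x - a)"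
proof -
  have "(\<integral>\<^sup>+ y. k (x - y) * v (y - a) \<partial>lborel)
      = (\<integral>\<^sup>+ y. k (x - (a + y)) * v (a + y - a) \<partial>lborel)"
    by (rule nn_integral_lborel_translate[symmetric]) auto
  then show ?thesis
    by (simp add: nn_conv_def diff_diff_add)
qed

lemma nn_conv_pow_translate:
  fixes k v :: "'a::euclidean_space \<Rightarrow> ennreal"
  assumes [measurable]: "k \<in> borel_measurable borel" "v \<in> borel_measurable borel"
  shows "(nn_conv (\<lambda>x. k (x - a)) ^^ n) (\<lambda>x. v (x - b)) = (\<lambda>x. (nn_conv k ^^ n) v (x - (b + real n *\<^sub>R a)))"
proof (induction n)
  case (Suc n)
  let ?f = "(nn_conv k ^^ n) v" and ?c = "b + real n *\<^sub>R a"
  have "nn_conv (\<lambda>x. k (x - a)) (\<lambda>x. ?f (x - ?c)) x = nn_conv k ?f (x - (b + real (Suc n) *\<^sub>R a))" for x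
  proof -
    have "nn_conv (\<lambda>x. k (x - a)) (\<lambda>x. ?f (x - ?c)) x = nn_conv k (\<lambda>x. ?f (x - (?c + a))) x"
      by (subst nn_conv_translate) (auto simp: algebra_simps)
    also have "\<dots> = nn_conv k ?f (x - (?c + a))"
      by (rule nn_conv_translate_right) auto
    finally show ?thesis
      by (simp add: algebra_simps)
  qed
  then show ?case
    by (simp add: Suc.IH fun_eq_iff)
qed simp

text \<open>By the arithmetic-geometric mean inequality the decay \<^term>\<open>(real j + 1) powr (- N / 2)\<close> of the
  densities is replaced by integer powers of \<^term>\<open>real j + 1\<close>, at the price of a free parameter.\<close>

lemma lattice_density_le:
  assumes "0 < a"
  shows "lattice_density h j (x :: 'a::euclidean_space) \<le> ennreal (a / (real j + 1) ^ DIM('a) + 1 / a)"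
proof -
  define r where "r = (\<Prod>b\<in>Basis. binomial_weight j \<lfloor>x \<bullet> b / h\<rfloor>)"
  have r: "0 \<le> r" "lattice_density h j x = ennreal r"
    by (auto simp: r_def lattice_density_def binomial_weight_nonneg prod_nonneg prod_ennreal)
  have "ennreal (r\<^sup>2 * (real j + 1) ^ DIM('a)) \<le> 1"
    using lattice_density_sq_le[of h j x] r by (simp add: ennreal_power ennreal_mult)
  then have "r\<^sup>2 * (real j + 1) ^ DIM('a) \<le> 1"
    by simp
  then have "a * r\<^sup>2 \<le> a * (1 / (real j + 1) ^ DIM('a))"
    using assms by (intro mult_left_mono) (auto simp: le_divide_eq)
  moreover have "2 * r \<le> a * r\<^sup>2 + 1 / a"
  proof -
    have "0 \<le> (a * r - 1)\<^sup>2 / a" using assms by simp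
    then show ?thesis using assms by (simp add: power2_eq_square field_simps)
  qed
  ultimately have "r \<le> a / (real j + 1) ^ DIM('a) + 1 / a"
    using r(1) by simp
  then show ?thesis
    using r(2) ennreal_leI by metis
qed

text \<open>For h > 0, the uniform probability density on the box with lowest corner
  \<open>a\<close> and side \<open>2 * h\<close>.\<close>

definition box_density :: "real \<Rightarrow> 'a::euclidean_space \<Rightarrow> 'a \<Rightarrow> ennreal" where
  "box_density h a x = ennreal (1 / h ^ DIM('a)) * lattice_density h 1 (x - a)"

lemma box_density_measurable [measurable]: "box_density h a \<in> borel_measurable borel"
  unfolding box_density_def[abs_def] by measurable

lemma nn_integral_box_density:
  assumes "h > 0"
  shows "(\<integral>\<^sup>+ x. box_density h a x \<partial>lborel) = 1"
proof -
  have "(\<integral>\<^sup>+ x. lattice_density h 1 (x - a) \<partial>lborel) = (\<integral>\<^sup>+ x. lattice_density h 1 (x :: 'a) \<partial>lborel)"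
    using nn_integral_lborel_translate[of "lattice_density h 1" "-a"] by simp
  then show ?thesis
    using assms unfolding box_density_def
    by (simp add: nn_integral_cmult nn_integral_lattice_density[unfolded One_nat_def] ennreal_mult[symmetric])
qed

text \<open>The bound from L1 to L-infinity for the powers of the box. \<open>r\<close> is the free
  parameter of the arithmetic-geometric mean, fixed only when the powers are summed.\<close>

lemma nn_conv_pow_box_density_le:
  fixes u :: "'a::euclidean_space \<Rightarrow> ennreal"
  assumes [measurable]: "u \<in> borel_measurable borel" and "h > 0" "r > 0"
  shows "(nn_conv (box_density h a) ^^ Suc n) u x
    \<le> ennreal (1 / h ^ DIM('a) * (r / (real (Suc n) + 1) ^ DIM('a) + 1 / r)) * (\<integral>\<^sup>+ y. u y \<partial>lborel)"
proof -
  let ?H = "1 / h ^ DIM('a)" and ?q = "lattice_density h :: nat \<Rightarrow> 'a \<Rightarrow> ennreal"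
  let ?B = "r / (real (Suc n) + 1) ^ DIM('a) + 1 / r"
  have sup: "(nn_conv (box_density h a) ^^ n) (box_density h a) y \<le> ennreal (?H * ?B)" for y
  proof -
    have "(nn_conv (box_density h a) ^^ n) (box_density h a) y
        = ennreal ?H ^ n * (ennreal ?H * (nn_conv (?q 1) ^^ n) (?q 1) (y - (a + real n *\<^sub>R a)))"
    proof -
      have "(nn_conv (box_density h a) ^^ n) (box_density h a)
        = (\<lambda>y. ennreal ?H ^ n * (nn_conv (\<lambda>x. ?q 1 (x - a)) ^^ n) (\<lambda>x. ennreal ?H * ?q 1 (x - a)) y)"
        unfolding box_density_def[abs_def] by (rule nn_conv_pow_cmult_left) auto
      also have "(nn_conv (\<lambda>x. ?q 1 (x - a)) ^^ n) (\<lambda>x. ennreal ?H * ?q 1 (x - a))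
        = (\<lambda>y. ennreal ?H * (nn_conv (\<lambda>x. ?q 1 (x - a)) ^^ n) (\<lambda>x. ?q 1 (x - a)) y)"
        \<comment> \<open>The scalar is pulled out as a linear combination with a single
          term.\<close>
        using nn_conv_pow_lincomb_right[of "\<lambda>x. ?q 1 (x - a)" "{()}" "\<lambda>_ x. ?q 1 (x - a)" n "\<lambda>_. ennreal ?H"]
        by simp
      finally show ?thesis
        by (simp add: nn_conv_pow_translate)
    qed
    also have "(nn_conv (?q 1) ^^ n) (?q 1) = (nn_conv (?q 0) ^^ n) (?q (Suc n))"
      by (rule nn_conv_pow_lattice_density[OF assms(2)])
    also have "ennreal ?H ^ n * (ennreal ?H * (nn_conv (?q 0) ^^ n) (?q (Suc n)) (y - (a + real n *\<^sub>R a)))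
      \<le> ennreal ?H ^ n * (ennreal ?H * (ennreal (h ^ DIM('a)) ^ n * ennreal ?B))"
    proof (intro mult_left_mono)
      have "?q (Suc n) z \<le> ennreal ?B" for z
        by (rule lattice_density_le[OF assms(3)])
      then show "(nn_conv (?q 0) ^^ n) (?q (Suc n)) (y - (a + real n *\<^sub>R a)) \<le> ennreal (h ^ DIM('a)) ^ n * ennreal ?B"
        using nn_conv_pow_le_sup[of "?q 0" "?q (Suc n)" "ennreal ?B" n] assms(2)
        by (simp add: nn_integral_lattice_density)
    qed auto
    \<comment> \<open>The n boxes of mass h^N cancel n of the n + 1 normalising factors
      \<open>?H\<close>, so the bound carries a single one for every n.\<close>
    also have "\<dots> = (ennreal ?H * ennreal (h ^ DIM('a))) ^ n * (ennreal ?H * ennreal ?B)"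
      by (simp only: power_mult_distrib ac_simps)
    also have "ennreal ?H * ennreal (h ^ DIM('a)) = 1"
      using assms(2) by (simp add: ennreal_mult[symmetric])
    also have "1 ^ n * (ennreal ?H * ennreal ?B) = ennreal (?H * ?B)"
      using assms(2,3) by (subst ennreal_mult) auto
    finally show ?thesis .
  qed
  \<comment> \<open>The iterate is convolution of \<open>u\<close> with the kernel just
    bounded.\<close>
  have "(nn_conv (box_density h a) ^^ Suc n) u = nn_conv ((nn_conv (box_density h a) ^^ n) (box_density h a)) u"
    by (subst nn_conv_pow_assoc) (auto simp: nn_conv_pow_commute)
  then show ?thesis
    using nn_conv_le_sup_left[OF _ assms(1) sup] by simp
qed

text \<open>Each factor n + i of (n + N)! / n! is at most i (n + 1).\<close>

lemma fact_add_le: "fact (n + N) \<le> fact N * fact n * (real n + 1) ^ N"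
proof (induction N)
  case (Suc N)
  have "fact (n + Suc N) = (real n + real N + 1) * fact (n + N)"
    by (simp add: algebra_simps)
  also have "\<dots> \<le> ((real N + 1) * (real n + 1)) * (fact N * fact n * (real n + 1) ^ N)"
    by (intro mult_mono Suc.IH) (auto simp: algebra_simps)
  also have "\<dots> = fact (Suc N) * fact n * (real n + 1) ^ Suc N"
    by (simp add: algebra_simps)
  finally show ?case .
qed simp

text \<open>Up to the factor exp(-s) this is a truncated negative moment of a Poisson variable. By
  \<open>fact_add_le\<close> the weight (n + 1)^(-N) turns n! into (n + N)! at the cost of N!, and
  the shifted sum is again part of the exponential series.\<close>

lemma poisson_inverse_moment:
  assumes "0 < s"
  shows "(\<Sum>n<m. s ^ n / fact n / (real n + 1) ^ N) \<le> fact N * exp s / s ^ N"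
proof -
  have "(\<Sum>n<m. s ^ n / fact n / (real n + 1) ^ N) \<le> (\<Sum>n<m. fact N / s ^ N * (s ^ (n + N) / fact (n + N)))"
  proof (intro sum_mono)
    fix n
    have "1 / (fact n * (real n + 1) ^ N) \<le> fact N / fact (n + N)"
      using fact_add_le[of n N] by (simp add: divide_simps mult_ac)
    then have "s ^ n * (1 / (fact n * (real n + 1) ^ N)) \<le> s ^ n * (fact N / fact (n + N))"
      using assms by (intro mult_left_mono) auto
    then show "s ^ n / fact n / (real n + 1) ^ N \<le> fact N / s ^ N * (s ^ (n + N) / fact (n + N))"
      using assms by (simp add: power_add mult_ac)
  qed
  also have "\<dots> = fact N / s ^ N * (\<Sum>n\<in>(\<lambda>n. n + N) ` {..<m}. s ^ n / fact n)"
    by (subst sum.reindex) (auto simp: sum_distrib_left)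
  also have "\<dots> \<le> fact N / s ^ N * (\<Sum>n<m + N. s ^ n / fact n)"
    using assms by (intro mult_left_mono sum_mono2) auto
  also have "\<dots> \<le> fact N / s ^ N * exp s"
    using assms by (intro mult_left_mono sum_le_exp) auto
  finally show ?thesis by simp
qed

text \<open>The power 0 is the identity and does not smooth, whence the summand V; all other powers
  are covered by \<open>nn_conv_pow_box_density_le\<close>.\<close>

lemma exp_sum_box_density_le:
  fixes u :: "'a::euclidean_space \<Rightarrow> ennreal"
  assumes [measurable]: "u \<in> borel_measurable borel" and "h > 0" "s > 0" and "\<And>y. u y \<le> V"
  shows "exp_sum m s (box_density h a) u x
    \<le> V + ennreal ((fact DIM('a) + 1) / h ^ DIM('a) * (exp s / sqrt s ^ DIM('a))) * (\<integral>\<^sup>+ y. u y \<partial>lborel)"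
proof -
  let ?N = "DIM('a)" and ?L = "\<integral>\<^sup>+ y. u y \<partial>lborel"
  \<comment> \<open>Balances r N! exp(s) / s^N against exp(s) / r: both become of order exp(s)
    s^(-N/2).\<close>
  let ?r = "sqrt s ^ ?N"
  let ?c = "\<lambda>n. 1 / h ^ ?N * (?r / (real n + 1) ^ ?N + 1 / ?r)"
  have r: "?r > 0" "s ^ ?N = ?r * ?r"
    using assms(3) by (simp_all add: power_mult_distrib[symmetric])
  have "exp_sum m s (box_density h a) u x
      \<le> (\<Sum>n<m. (if n = 0 then V else 0) + ennreal (s ^ n / fact n * ?c n) * ?L)"
    unfolding exp_sum_def
  proof (intro sum_mono)
    fix n
    show "ennreal (s ^ n / fact n) * (nn_conv (box_density h a) ^^ n) u x
      \<le> (if n = 0 then V else 0) + ennreal (s ^ n / fact n * ?c n) * ?L"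
    proof (cases n)
      case 0
      then show ?thesis
        using assms(4)[of x] by (simp add: add_increasing2)
    next
      case (Suc k)
      have "ennreal (s ^ n / fact n) * (nn_conv (box_density h a) ^^ n) u x
          \<le> ennreal (s ^ n / fact n) * (ennreal (?c n) * ?L)"
        unfolding Suc using r by (intro mult_left_mono nn_conv_pow_box_density_le assms) auto
      also have "\<dots> = ennreal (s ^ n / fact n * ?c n) * ?L"
        using assms(2,3) r(1) by (subst ennreal_mult) (auto simp: mult.assoc)
      finally show ?thesis
        using Suc by simp
    qed
  qed
  also have "\<dots> = (\<Sum>n<m. (if n = 0 then V else 0)) + (\<Sum>n<m. ennreal (s ^ n / fact n * ?c n)) * ?L"
    by (simp add: sum.distrib sum_distrib_right)
  also have "(\<Sum>n<m. ennreal (s ^ n / fact n * ?c n)) = ennreal (\<Sum>n<m. s ^ n / fact n * ?c n)"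
    using assms(2,3) r(1) by (intro sum_ennreal) auto
  also have "(\<Sum>n<m. (if n = 0 then V else 0)) + ennreal (\<Sum>n<m. s ^ n / fact n * ?c n) * ?L
      \<le> V + ennreal ((fact ?N + 1) / h ^ ?N * (exp s / ?r)) * ?L"
  proof (intro add_mono mult_right_mono ennreal_leI)
    show "(\<Sum>n<m. (if n = 0 then V else 0)) \<le> V"
      by (simp add: sum.delta)
    have "(\<Sum>n<m. s ^ n / fact n * ?c n)
        = (?r * (\<Sum>n<m. s ^ n / fact n / (real n + 1) ^ ?N) + (\<Sum>n<m. s ^ n / fact n) / ?r) / h ^ ?N"
      by (simp add: sum_distrib_left sum_divide_distrib sum.distrib[symmetric] algebra_simps add_divide_distrib)
    also have "\<dots> \<le> (?r * (fact ?N * exp s / s ^ ?N) + exp s / ?r) / h ^ ?N"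
      using assms(2,3) r(1)
      by (intro divide_right_mono add_mono mult_left_mono poisson_inverse_moment sum_le_exp) auto
    also have "\<dots> = (fact ?N + 1) / h ^ ?N * (exp s / ?r)"
      using r(1) unfolding r(2) by (simp add: field_simps)
    finally show "(\<Sum>n<m. s ^ n / fact n * ?c n) \<le> (fact ?N + 1) / h ^ ?N * (exp s / ?r)" .
  qed auto
  finally show ?thesis .
qed

text \<open>The series of G acts first and costs exp(t c) in sup norm and in mass alike; the series
  of the box then smooths the result.\<close>

lemma exp_sum_minorized_le:
  fixes G w :: "'a::euclidean_space \<Rightarrow> ennreal"
  assumes [measurable]: "G \<in> borel_measurable borel" "w \<in> borel_measurable borel"
    and "h > 0" "\<theta> > 0" "t > 0" "0 \<le> c" "(\<integral>\<^sup>+ y. G y \<partial>lborel) \<le> ennreal c" "\<And>y. w y \<le> V"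
  shows "exp_sum m t (\<lambda>z. ennreal \<theta> * box_density h a z + G z) w x
    \<le> ennreal (exp (t * c)) * (V + ennreal ((fact DIM('a) + 1) / h ^ DIM('a) * (exp (\<theta> * t) / sqrt (\<theta> * t) ^ DIM('a))) * (\<integral>\<^sup>+ y. w y \<partial>lborel))"
proof -
  let ?C = "ennreal ((fact DIM('a) + 1) / h ^ DIM('a) * (exp (\<theta> * t) / sqrt (\<theta> * t) ^ DIM('a)))"
  let ?u = "exp_sum m t G w"
  have "exp_sum m t (\<lambda>z. ennreal \<theta> * box_density h a z + G z) w x
      \<le> exp_sum m t (\<lambda>z. ennreal \<theta> * box_density h a z) ?u x"
    using assms(5) by (intro exp_sum_add_le) auto
  also have "\<dots> = exp_sum m (\<theta> * t) (box_density h a) ?u x"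
    using assms(4,5) by (subst exp_sum_cmult_kernel) auto
  also have "\<dots> \<le> ennreal (exp (t * c)) * V + ?C * (\<integral>\<^sup>+ y. ?u y \<partial>lborel)"
    using assms(3-8) by (intro exp_sum_box_density_le exp_sum_le_sup) auto
  also have "\<dots> \<le> ennreal (exp (t * c)) * V + ?C * (ennreal (exp (t * c)) * (\<integral>\<^sup>+ y. w y \<partial>lborel))"
    using assms(5-7) by (intro add_mono mult_left_mono nn_integral_exp_sum_le) auto
  finally show ?thesis
    by (simp add: distrib_left ac_simps)
qed

section \<open>Exponential tilting\<close>

text \<open>What the estimates use of the kernel: a multiple of a box density below it provides the
  smoothing, while evenness and bounded support control the tilting.\<close>

locale minorized_kernel =
  fixes J :: "'a::euclidean_space \<Rightarrow> real" and \<rho> \<theta> h :: real and a :: 'a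
  assumes J_measurable [measurable]: "J \<in> borel_measurable borel"
    and J_nonneg: "0 \<le> J z"
    and J_even: "J (- z) = J z"
    and J_integral: "(\<integral>\<^sup>+ z. ennreal (J z) \<partial>lborel) = 1"
    and J_support: "J z \<noteq> 0 \<Longrightarrow> norm z \<le> \<rho>"
    and rho_pos: "\<rho> > 0" and theta_pos: "\<theta> > 0" and h_pos: "h > 0"
    and box_density_le_J: "ennreal \<theta> * box_density h a z \<le> ennreal (J z)"

text \<open>For s \<ge> 0 the excess over 2 is (1 - exp(-s))^2 exp(s), where 0 \<le> 1 - exp(-s)
  \<le> s; negative s follow by symmetry. No term linear in s survives.\<close>

lemma exp_plus_exp_uminus_le:
  fixes s :: real
  shows "exp s + exp (- s) \<le> 2 + s\<^sup>2 * exp \<bar>s\<bar>"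
proof -
  have *: "exp s + exp (- s) \<le> 2 + s\<^sup>2 * exp s" if "0 \<le> s" for s :: real
  proof -
    have "1 - exp (- s) \<le> s"
      using exp_ge_add_one_self[of "- s"] by simp
    moreover have "0 \<le> 1 - exp (- s)" using that by simp
    ultimately have "(1 - exp (- s))\<^sup>2 \<le> s\<^sup>2"
      by (intro power_mono) auto
    then have "(1 - exp (- s))\<^sup>2 * exp s \<le> s\<^sup>2 * exp s"
      by (rule mult_right_mono) simp
    moreover have "(1 - exp (- s))\<^sup>2 * exp s = exp s + exp (- s) - 2"
    proof -
      have "exp (- s) * exp s = 1" by (simp add: exp_minus)
      moreover have "(1 - exp (- s))\<^sup>2 * exp s = exp s - 2 * (exp (- s) * exp s) + exp (- s) * (exp (- s) * exp s)"
        by (simp add: power2_eq_square algebra_simps)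
      ultimately show ?thesis by simp
    qed
    ultimately show ?thesis by simp
  qed
  show ?thesis
  proof (cases "0 \<le> s")
    case True
    then show ?thesis using * by simp
  next
    case False
    then show ?thesis using *[of "- s"] by (simp add: add.commute)
  qed
qed

context minorized_kernel
begin

definition tilted :: "'a \<Rightarrow> 'a \<Rightarrow> ennreal" where
  "tilted l z = ennreal (J z * exp (l \<bullet> z))"

text \<open>The coefficient of |l|^2 in the mass gained by tilting.\<close>

definition rate :: real where "rate = \<rho>\<^sup>2 * exp \<rho> / 2"

text \<open>On the support of J a tilt with |l| \<le> 1 is at least exp(-\<rho>), so this multiple
  of the box density lies below every such tilted kernel.\<close>

definition minorant :: real where "minorant = \<theta> * exp (- \<rho>)"

lemma tilted_measurable [measurable]: "tilted l \<in> borel_measurable borel"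
  unfolding tilted_def[abs_def] by measurable

lemma rate_nonneg: "0 \<le> rate"
  by (simp add: rate_def)

lemma minorant_pos: "0 < minorant"
  using theta_pos by (simp add: minorant_def)

lemma nn_integral_tilted_le:
  assumes "norm l \<le> 1"
  shows "(\<integral>\<^sup>+ z. tilted l z \<partial>lborel) \<le> ennreal (1 + rate * (norm l)\<^sup>2)"
proof -
  \<comment> \<open>Averaging with the reflected integrand cancels the part linear in l, since J is
    even.\<close>
  have "(\<integral>\<^sup>+ z. tilted l (0 - z) \<partial>lborel) = (\<integral>\<^sup>+ z. tilted l z \<partial>lborel)"
    by (rule nn_integral_lborel_reflect) auto
  then have "2 * (\<integral>\<^sup>+ z. tilted l z \<partial>lborel) = (\<integral>\<^sup>+ z. tilted l z + tilted l (- z) \<partial>lborel)"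
    by (subst nn_integral_add) (auto simp: mult_2)
  also have "\<dots> \<le> (\<integral>\<^sup>+ z. ennreal (2 * (1 + rate * (norm l)\<^sup>2)) * ennreal (J z) \<partial>lborel)"
  proof (rule nn_integral_mono)
    fix z
    have "J z * (exp (l \<bullet> z) + exp (- (l \<bullet> z))) \<le> J z * (2 * (1 + rate * (norm l)\<^sup>2))"
    proof (cases "J z = 0")
      case False
      then have z: "norm z \<le> \<rho>" by (rule J_support)
      have lz: "\<bar>l \<bullet> z\<bar> \<le> norm l * \<rho>"
        using Cauchy_Schwarz_ineq2[of l z] mult_left_mono[OF z, of "norm l"] by simp
      also have "norm l * \<rho> \<le> \<rho>"
        using assms rho_pos by (simp add: mult_left_le_one_le)
      finally have "exp \<bar>l \<bullet> z\<bar> \<le> exp \<rho>" by simp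
      moreover have "(l \<bullet> z)\<^sup>2 \<le> (norm l * \<rho>)\<^sup>2"
        using power_mono[OF lz, of 2] by simp
      ultimately have "(l \<bullet> z)\<^sup>2 * exp \<bar>l \<bullet> z\<bar> \<le> (norm l * \<rho>)\<^sup>2 * exp \<rho>"
        by (intro mult_mono) auto
      then have "exp (l \<bullet> z) + exp (- (l \<bullet> z)) \<le> 2 * (1 + rate * (norm l)\<^sup>2)"
        using exp_plus_exp_uminus_le[of "l \<bullet> z"] by (simp add: rate_def power_mult_distrib algebra_simps)
      then show ?thesis
        by (rule mult_left_mono) (rule J_nonneg)
    qed simp
    then have "ennreal (J z * (exp (l \<bullet> z) + exp (- (l \<bullet> z)))) \<le> ennreal (J z * (2 * (1 + rate * (norm l)\<^sup>2)))"
      by (rule ennreal_leI)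
    moreover have "ennreal (J z * (2 * (1 + rate * (norm l)\<^sup>2))) = ennreal (2 * (1 + rate * (norm l)\<^sup>2)) * ennreal (J z)"
      using J_nonneg[of z] rate_nonneg by (subst ennreal_mult) (auto simp: mult.commute)
    ultimately show "tilted l z + tilted l (- z) \<le> ennreal (2 * (1 + rate * (norm l)\<^sup>2)) * ennreal (J z)"
      using J_nonneg[of z] by (simp add: tilted_def J_even ennreal_plus[symmetric] distrib_left del: ennreal_plus)
  qed
  also have "\<dots> = 2 * ennreal (1 + rate * (norm l)\<^sup>2)"
    using rate_nonneg by (subst nn_integral_cmult) (auto simp: J_integral ennreal_mult)
  finally show ?thesis
    by (subst (asm) ennreal_mult_le_mult_iff) auto
qed

lemma minorant_box_density_le_tilted:
  assumes "norm l \<le> 1"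
  shows "ennreal minorant * box_density h a z \<le> tilted l z"
proof (cases "J z = 0")
  case True
  then have "box_density h a z = 0"
    using box_density_le_J[of z] theta_pos by simp
  then show ?thesis by simp
next
  case False
  have "\<bar>l \<bullet> z\<bar> \<le> 1 * \<rho>"
    using Cauchy_Schwarz_ineq2[of l z] mult_mono[OF assms J_support[OF False]] by simp
  then have "exp (- \<rho>) \<le> exp (l \<bullet> z)" by simp
  then have "ennreal (J z) * ennreal (exp (- \<rho>)) \<le> ennreal (J z) * ennreal (exp (l \<bullet> z))"
    by (intro mult_left_mono ennreal_leI) auto
  moreover have "ennreal minorant * box_density h a z \<le> ennreal (J z) * ennreal (exp (- \<rho>))"
    using mult_right_mono[OF box_density_le_J[of z], of "ennreal (exp (- \<rho>))"] theta_pos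
    by (simp add: minorant_def ennreal_mult mult_ac)
  ultimately show ?thesis
    using J_nonneg[of z] by (simp add: tilted_def ennreal_mult)
qed

text \<open>The constant in front of t^(-N/2), common to all tilts with |l| \<le> 1.\<close>

definition decay_const :: real where
  "decay_const = (fact DIM('a) + 1) / h ^ DIM('a) / sqrt minorant ^ DIM('a)"

lemma decay_const_pos: "0 < decay_const"
  using h_pos minorant_pos by (simp add: decay_const_def add_pos_pos)

text \<open>Removing the box lowers the mass of the rest by \<open>minorant\<close>, which gains
  exp(-minorant t). On the smoothed part the growth of the box series cancels this gain; on the
  unsmoothed term V it remains as exponential decay.\<close>

lemma exp_sum_tilted_le:
  assumes [measurable]: "w \<in> borel_measurable borel"
    and l: "norm l \<le> 1" and t: "t > 0" and w: "\<And>y. w y \<le> ennreal V"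
  shows "exp_sum m t (tilted l) w x
    \<le> ennreal (exp (t + t * (rate * (norm l)\<^sup>2))) *
       (ennreal (exp (- minorant * t)) * ennreal V + ennreal (decay_const / sqrt t ^ DIM('a)) * (\<integral>\<^sup>+ y. w y \<partial>lborel))"
proof -
  let ?B = "\<lambda>z. ennreal minorant * box_density h a z"
  \<comment> \<open>Subtraction in \<open>ennreal\<close> is truncated at 0; the domination of the
    box makes it exact here.\<close>
  define G where "G z = tilted l z - ?B z" for z
  have [measurable]: "G \<in> borel_measurable borel"
    unfolding G_def by measurable
  have tilted_eq: "tilted l = (\<lambda>z. ?B z + G z)"
  proof
    fix z
    show "tilted l z = ?B z + G z"
      using minorant_box_density_le_tilted[OF l, of z]
      by (simp add: G_def add_diff_inverse_ennreal)
  qed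
  have "(\<integral>\<^sup>+ z. tilted l z \<partial>lborel) = ennreal minorant + (\<integral>\<^sup>+ z. G z \<partial>lborel)"
    unfolding tilted_eq using h_pos
    by (subst nn_integral_add) (simp_all add: nn_integral_cmult nn_integral_box_density)
  then have le: "ennreal minorant + (\<integral>\<^sup>+ z. G z \<partial>lborel) \<le> ennreal (1 + rate * (norm l)\<^sup>2)"
    using nn_integral_tilted_le[OF l] by simp
  define c where "c = 1 + rate * (norm l)\<^sup>2 - minorant"
  have c: "0 \<le> c" "(\<integral>\<^sup>+ z. G z \<partial>lborel) \<le> ennreal c"
  proof -
    have "ennreal minorant \<le> ennreal (1 + rate * (norm l)\<^sup>2)"
      using le by (rule order_trans[rotated]) simp
    then show "0 \<le> c"
      using rate_nonneg by (subst (asm) ennreal_le_iff) (auto simp: c_def)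
    \<comment> \<open>Infinite values of \<open>ennreal\<close> cannot be cancelled, so the integral
      is first shown to be finite and then made real.\<close>
    have "(\<integral>\<^sup>+ z. G z \<partial>lborel) \<noteq> top"
      using le by (auto simp: top_unique)
    then obtain g where g: "(\<integral>\<^sup>+ z. G z \<partial>lborel) = ennreal g" "0 \<le> g"
      by (cases "\<integral>\<^sup>+ z. G z \<partial>lborel") auto
    then have "minorant + g \<le> 1 + rate * (norm l)\<^sup>2"
      using le minorant_pos rate_nonneg by (simp add: ennreal_plus[symmetric] del: ennreal_plus)
    then show "(\<integral>\<^sup>+ z. G z \<partial>lborel) \<le> ennreal c"
      using g by (simp add: c_def ennreal_leI)
  qed
  let ?D = "(fact DIM('a) + 1) / h ^ DIM('a) * (exp (minorant * t) / sqrt (minorant * t) ^ DIM('a))"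
  have "exp_sum m t (tilted l) w x \<le> ennreal (exp (t * c)) * (ennreal V + ennreal ?D * (\<integral>\<^sup>+ y. w y \<partial>lborel))"
    unfolding tilted_eq using h_pos minorant_pos t c w by (intro exp_sum_minorized_le) auto
  also have "ennreal (exp (t * c)) = ennreal (exp (t + t * (rate * (norm l)\<^sup>2))) * ennreal (exp (- minorant * t))"
    by (simp add: ennreal_mult[symmetric] exp_add[symmetric] c_def algebra_simps)
  also have "ennreal ?D = ennreal (exp (minorant * t)) * ennreal (decay_const / sqrt t ^ DIM('a))"
  proof -
    have "?D = exp (minorant * t) * (decay_const / sqrt t ^ DIM('a))"
      by (simp add: decay_const_def real_sqrt_mult power_mult_distrib mult_ac)
    then show ?thesis
      using decay_const_pos t by (simp only: ennreal_mult'' divide_nonneg_nonneg less_imp_le zero_le_power real_sqrt_ge_zero)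
  qed
  also have "ennreal (exp (t + t * (rate * (norm l)\<^sup>2))) * ennreal (exp (- minorant * t)) *
      (ennreal V + ennreal (exp (minorant * t)) * ennreal (decay_const / sqrt t ^ DIM('a)) * (\<integral>\<^sup>+ y. w y \<partial>lborel))
    = ennreal (exp (t + t * (rate * (norm l)\<^sup>2))) *
      (ennreal (exp (- minorant * t)) * ennreal V + (ennreal (exp (- minorant * t)) * ennreal (exp (minorant * t))) *
         (ennreal (decay_const / sqrt t ^ DIM('a)) * (\<integral>\<^sup>+ y. w y \<partial>lborel)))"
    by (simp only: distrib_left mult.assoc)
  also have "ennreal (exp (- minorant * t)) * ennreal (exp (minorant * t)) = 1"
    by (simp add: ennreal_mult[symmetric] exp_add[symmetric])
  finally show ?thesis by simp
qed

text \<open>Conjugation by the weight exp(l . x) turns convolution with J into convolution with the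
  tilted kernel, since exp(l . (x - y)) exp(l . y) = exp(l . x).\<close>

lemma nn_conv_pow_tilt:
  assumes [measurable]: "v \<in> borel_measurable borel"
  shows "(nn_conv (tilted l) ^^ n) (\<lambda>y. ennreal (exp (l \<bullet> y)) * v y)
    = (\<lambda>x. ennreal (exp (l \<bullet> x)) * (nn_conv (\<lambda>z. ennreal (J z)) ^^ n) v x)"
proof (induction n)
  case (Suc n)
  let ?f = "(nn_conv (\<lambda>z. ennreal (J z)) ^^ n) v"
  have "nn_conv (tilted l) (\<lambda>y. ennreal (exp (l \<bullet> y)) * ?f y) x
      = ennreal (exp (l \<bullet> x)) * nn_conv (\<lambda>z. ennreal (J z)) ?f x" for x
  proof -
    have "tilted l (x - y) * (ennreal (exp (l \<bullet> y)) * ?f y)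
        = ennreal (exp (l \<bullet> x)) * (ennreal (J (x - y)) * ?f y)" for y
    proof -
      have "tilted l (x - y) * ennreal (exp (l \<bullet> y)) = ennreal (exp (l \<bullet> x)) * ennreal (J (x - y))"
        using J_nonneg[of "x - y"]
        by (simp add: tilted_def ennreal_mult[symmetric] mult.assoc exp_add[symmetric] inner_diff_right mult.commute)
      then show ?thesis
        by (simp only: mult.assoc[symmetric])
    qed
    then show ?thesis
      unfolding nn_conv_def[of _ _ x] by (simp add: nn_integral_cmult)
  qed
  then show ?case
    by (simp add: Suc.IH fun_eq_iff)
qed simp

lemma exp_sum_tilt:
  assumes [measurable]: "v \<in> borel_measurable borel"
  shows "exp_sum m t (tilted l) (\<lambda>y. ennreal (exp (l \<bullet> y)) * v y) x
    = ennreal (exp (l \<bullet> x)) * exp_sum m t (\<lambda>z. ennreal (J z)) v x"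
  unfolding exp_sum_def nn_conv_pow_tilt[OF assms] sum_distrib_left
  by (intro sum.cong refl) (simp only: ac_simps)

text \<open>Tilt, estimate, untilt. The condition t |l|^2 \<le> 1 keeps the mass growth exp(t rate
  |l|^2) below exp(rate), and \<open>b\<close> bounds the tilt on the support of \<open>v\<close>,
  so the net gain is exp(b - l . x). The first bound contains the smoothing, the second uses the sup
  norm alone.\<close>

lemma exp_sum_J_le:
  assumes [measurable]: "v \<in> borel_measurable borel"
    and l: "norm l \<le> 1" and t: "t > 0" "t * (norm l)\<^sup>2 \<le> 1" and V: "\<And>y. v y \<le> ennreal V" "0 \<le> V"
    and b: "\<And>y. v y \<noteq> 0 \<Longrightarrow> l \<bullet> y \<le> b"
  shows "ennreal (exp (- t)) * exp_sum m t (\<lambda>z. ennreal (J z)) v x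
      \<le> ennreal (exp (rate + b - l \<bullet> x)) *
         (ennreal (exp (- minorant * t) * V) + ennreal (decay_const / sqrt t ^ DIM('a)) * (\<integral>\<^sup>+ y. v y \<partial>lborel))" (is ?A)
    and "ennreal (exp (- t)) * exp_sum m t (\<lambda>z. ennreal (J z)) v x \<le> ennreal (exp (rate + b - l \<bullet> x) * V)" (is ?B)
proof -
  let ?w = "\<lambda>y. ennreal (exp (l \<bullet> y)) * v y" and ?S = "exp_sum m t (\<lambda>z. ennreal (J z)) v x"
  let ?L = "\<integral>\<^sup>+ y. v y \<partial>lborel" and ?r = "rate * (norm l)\<^sup>2"
  have w: "?w y \<le> ennreal (exp b) * v y" for y
    using b[of y] by (cases "v y = 0") (auto intro!: mult_right_mono ennreal_leI)
  have wV: "?w y \<le> ennreal (exp b * V)" for y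
    using w[of y] mult_left_mono[OF V(1)[of y], of "ennreal (exp b)"] V(2)
    by (simp add: ennreal_mult order_trans)
  have wL: "(\<integral>\<^sup>+ y. ?w y \<partial>lborel) \<le> ennreal (exp b) * ?L"
    by (subst nn_integral_cmult[symmetric]) (auto intro!: nn_integral_mono w)
  have r: "t * ?r \<le> rate"
    using mult_left_mono[OF t(2) rate_nonneg] by (simp add: mult_ac)
  have S: "ennreal (exp (- t)) * ?S
      = ennreal (exp (- t - l \<bullet> x)) * exp_sum m t (tilted l) ?w x"
    unfolding exp_sum_tilt[OF assms(1)]
    by (simp add: mult.assoc[symmetric] ennreal_mult[symmetric] exp_add[symmetric])
  have coeff: "ennreal (exp (- t - l \<bullet> x)) * ennreal (exp (t + t * ?r)) * ennreal (exp b) \<le> ennreal (exp (rate + b - l \<bullet> x))"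
    using r by (simp add: ennreal_mult[symmetric] exp_add[symmetric])
  have "exp_sum m t (tilted l) ?w x \<le> ennreal (exp (t + t * ?r)) *
       (ennreal (exp (- minorant * t)) * ennreal (exp b * V) + ennreal (decay_const / sqrt t ^ DIM('a)) * (\<integral>\<^sup>+ y. ?w y \<partial>lborel))"
    by (rule exp_sum_tilted_le[OF _ l t(1) wV]) auto
  also have "\<dots> \<le> ennreal (exp (t + t * ?r)) *
       (ennreal (exp (- minorant * t)) * ennreal (exp b * V) + ennreal (decay_const / sqrt t ^ DIM('a)) * (ennreal (exp b) * ?L))"
    by (intro mult_left_mono add_mono wL) auto
  also have "\<dots> = ennreal (exp (t + t * ?r)) * ennreal (exp b) *
       (ennreal (exp (- minorant * t) * V) + ennreal (decay_const / sqrt t ^ DIM('a)) * ?L)"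
    using V(2) by (simp add: ennreal_mult distrib_left mult_ac)
  finally have "ennreal (exp (- t)) * ?S \<le> ennreal (exp (- t - l \<bullet> x)) * (ennreal (exp (t + t * ?r)) * ennreal (exp b) *
       (ennreal (exp (- minorant * t) * V) + ennreal (decay_const / sqrt t ^ DIM('a)) * ?L))"
    unfolding S by (rule mult_left_mono) simp
  also have "\<dots> \<le> ennreal (exp (rate + b - l \<bullet> x)) *
         (ennreal (exp (- minorant * t) * V) + ennreal (decay_const / sqrt t ^ DIM('a)) * ?L)"
    unfolding mult.assoc[symmetric] by (intro mult_right_mono) (use coeff in \<open>simp_all only: mult.assoc zero_le\<close>)
  finally show ?A .
  have "exp_sum m t (tilted l) ?w x \<le> ennreal (exp (t * (1 + ?r))) * ennreal (exp b * V)"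
    using t(1) rate_nonneg nn_integral_tilted_le[OF l] by (intro exp_sum_le_sup wV) auto
  then have "ennreal (exp (- t)) * ?S \<le> ennreal (exp (- t - l \<bullet> x)) * (ennreal (exp (t * (1 + ?r))) * ennreal (exp b * V))"
    unfolding S by (rule mult_left_mono) simp
  also have "\<dots> = ennreal (exp (- t - l \<bullet> x)) * ennreal (exp (t + t * ?r)) * ennreal (exp b) * ennreal V"
    using V(2) by (simp add: ennreal_mult mult.assoc distrib_left)
  also have "\<dots> \<le> ennreal (exp (rate + b - l \<bullet> x)) * ennreal V"
    by (intro mult_right_mono coeff) auto
  finally show ?B
    using V(2) by (simp add: ennreal_mult)
qed

end

text \<open>A continuous kernel that is positive at \<open>a\<close> exceeds J(a)/2 on a ball around
  \<open>a\<close>, and this ball contains a box with corner \<open>a\<close>.\<close>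

lemma diffusion_kernel_minorized:
  fixes J :: "'a::euclidean_space \<Rightarrow> real"
  assumes "diffusion_kernel J"
  obtains \<rho> \<theta> h a where "minorized_kernel J \<rho> \<theta> h a"
proof -
  have cont: "continuous_on UNIV J" and cpt: "compact (closure {x. J x \<noteq> 0})"
    and radial: "\<And>x y. norm x = norm y \<Longrightarrow> J x = J y" and nonneg: "\<And>x. 0 \<le> J x"
    and int: "(LINT x|lebesgue. J x) = 1"
    using assms C_k.simps(1) unfolding diffusion_kernel_def smooth_compact_support_def by blast+
  have [measurable]: "J \<in> borel_measurable borel"
    using cont by (rule borel_measurable_continuous_onI)
  obtain \<rho> where rho: "\<rho> > 0" "\<And>x. J x \<noteq> 0 \<Longrightarrow> norm x \<le> \<rho>"
  proof -
    have "bounded {x. J x \<noteq> 0}"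
      using cpt compact_imp_bounded bounded_closure_image bounded_subset closure_subset by metis
    then show ?thesis
      using that unfolding bounded_pos by auto
  qed
  \<comment> \<open>The integral of a non-integrable function is 0 by convention, so the value 1
    forces integrability.\<close>
  have "integrable lborel J"
  proof (rule ccontr)
    assume "\<not> integrable lborel J"
    then have "\<not> integrable lebesgue J"
      by (subst integrable_completion) auto
    then show False
      using int not_integrable_integral_eq by fastforce
  qed
  moreover have "(LINT x|lborel. J x) = 1"
    using int by (subst (asm) integral_completion) auto
  ultimately have nn: "(\<integral>\<^sup>+ z. ennreal (J z) \<partial>lborel) = 1"
    using nn_integral_eq_integral[of lborel J] nonneg by simp
  have "\<exists>z. J z \<noteq> 0"
  proof (rule ccontr)
    assume "\<nexists>z. J z \<noteq> 0"
    then show False using nn by simp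
  qed
  then obtain a where a: "J a > 0"
    using nonneg by (metis less_eq_real_def)
  obtain r where r: "r > 0" "\<And>z. dist z a < r \<Longrightarrow> J a / 2 < J z"
  proof -
    have "isCont J a" using cont by (simp add: continuous_on_eq_continuous_at)
    then obtain r where "r > 0" "\<And>z. dist z a < r \<Longrightarrow> dist (J z) (J a) < J a / 2"
      using a unfolding continuous_at_eps_delta by (metis half_gt_zero)
    moreover have "J a / 2 < J z" if "dist (J z) (J a) < J a / 2" for z
      using that by (simp add: dist_real_def abs_if split: if_splits)
    ultimately show ?thesis
      using that by blast
  qed
  \<comment> \<open>A point of the box then has distance at most 2 h N = r/2 from the
    corner.\<close>
  define h where "h = r / (4 * DIM('a))"
  have h: "h > 0" using r(1) by (simp add: h_def)
  \<comment> \<open>The box density is at most 2 / h^N, by \<open>lattice_density_le\<close> with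
    parameter 1; this factor brings it down to J(a)/2.\<close>
  define \<theta> where "\<theta> = J a / 4 * h ^ DIM('a)"
  have \<theta>: "\<theta> > 0" using a h by (simp add: \<theta>_def)
  have minor: "ennreal \<theta> * box_density h a z \<le> ennreal (J z)" for z
  proof (cases "\<exists>b\<in>Basis. (z - a) \<bullet> b < 0 \<or> 2 * h \<le> (z - a) \<bullet> b")
    case True
    then have "box_density h a z = 0"
      using lattice_density_1_eq_0[OF h] by (force simp: box_density_def)
    then show ?thesis by simp
  next
    case False
    then have "\<bar>(z - a) \<bullet> b\<bar> \<le> 2 * h" if "b \<in> Basis" for b
      using that by (force simp: not_less abs_if)
    then have "norm (z - a) \<le> (\<Sum>b\<in>(Basis::'a set). 2 * h)"
      by (intro order_trans[OF norm_le_l1] sum_mono)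
    also have "\<dots> < r"
      using r(1) by (simp add: h_def)
    finally have Jz: "J a / 2 \<le> J z"
      using r(2)[of z] by (simp add: dist_norm)
    have "lattice_density h 1 (z - a) \<le> ennreal (1 / (real 1 + 1) ^ DIM('a) + 1 / 1)"
      by (rule lattice_density_le) simp
    also have "\<dots> \<le> ennreal 2"
      by (intro ennreal_leI) (simp add: divide_le_eq)
    finally have "box_density h a z \<le> ennreal (1 / h ^ DIM('a)) * ennreal 2"
      unfolding box_density_def by (rule mult_left_mono) simp
    then have "ennreal \<theta> * box_density h a z \<le> ennreal \<theta> * (ennreal (1 / h ^ DIM('a)) * ennreal 2)"
      by (rule mult_left_mono) simp
    also have "\<dots> = ennreal (\<theta> * (1 / h ^ DIM('a) * 2))"
      using \<theta> h by (metis divide_nonneg_nonneg ennreal_mult less_imp_le mult_nonneg_nonneg zero_le_numeral zero_le_one zero_le_power)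
    also have "\<theta> * (1 / h ^ DIM('a) * 2) = J a / 2"
      using h by (simp add: \<theta>_def)
    finally show ?thesis
      using Jz by (meson ennreal_leI order_trans)
  qed
  have "minorized_kernel J \<rho> \<theta> h a"
    using rho nonneg nn \<theta> h minor radial[of "- _"] by unfold_locales auto
  then show ?thesis by (rule that)
qed

section \<open>Comparison with the exponential series\<close>

lemma Suc_mult_power_div_fact: "real (Suc n) * t ^ n / fact (Suc n) = t ^ n / (fact n :: real)"
  by (simp add: fact_Suc del: of_nat_Suc)

text \<open>Differentiation shifts the coefficients by one, as convolution with J will do to the
  iterates.\<close>

lemma has_real_derivative_exp_partial_sum:
  fixes c :: "nat \<Rightarrow> real"
  shows "((\<lambda>t. \<Sum>i<Suc n. t ^ i / fact i * c i) has_real_derivative (\<Sum>i<n. t ^ i / fact i * c (Suc i))) (at t)"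
proof (induction n)
  case (Suc n)
  have "((\<lambda>t. t ^ Suc n / fact (Suc n) * c (Suc n)) has_real_derivative
      (real (Suc n) * t ^ n / fact (Suc n) * c (Suc n))) (at t)"
    by (rule derivative_eq_intros refl | simp)+
  then have "((\<lambda>t. t ^ Suc n / fact (Suc n) * c (Suc n)) has_real_derivative
      (t ^ n / fact n * c (Suc n))) (at t)"
    by (simp only: Suc_mult_power_div_fact)
  from DERIV_add[OF Suc.IH this] show ?case
    by (simp only: sum.lessThan_Suc)
qed simp

context minorized_kernel
begin

section \<open>Averaging against translates of the kernel\<close>

lemma J_translate_measurable [measurable]: "(\<lambda>y. J (x - y)) \<in> borel_measurable lebesgue"
  by (rule measurable_completion) simp

lemma nn_integral_J_translate: "(\<integral>\<^sup>+ y. ennreal (J (x - y)) \<partial>lebesgue) = 1"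
  using nn_integral_lborel_reflect[of "\<lambda>z. ennreal (J z)" x] J_integral
  by (simp add: nn_integral_completion)

lemma integrable_J_translate: "integrable lebesgue (\<lambda>y. J (x - y))"
  by (rule integrableI_nonneg) (simp_all add: J_nonneg nn_integral_J_translate)

lemma integral_J_translate: "(LINT y|lebesgue. J (x - y)) = 1"
  by (subst integral_eq_nn_integral) (simp_all add: J_nonneg nn_integral_J_translate)

lemma integrable_J_mult:
  assumes [measurable]: "w \<in> borel_measurable lebesgue" and "AE y in lebesgue. \<bar>w y\<bar> \<le> K"
  shows "integrable lebesgue (\<lambda>y. J (x - y) * w y)"
proof (rule Bochner_Integration.integrable_bound)
  show "integrable lebesgue (\<lambda>y. K * J (x - y))"
    by (intro integrable_mult_right integrable_J_translate)
  show "AE y in lebesgue. norm (J (x - y) * w y) \<le> norm (K * J (x - y))"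
    using assms(2)
  proof eventually_elim
    case (elim y)
    then show ?case
      using J_nonneg[of "x - y"] mult_left_mono[of "\<bar>w y\<bar>" "\<bar>K\<bar>" "J (x - y)"]
      by (simp add: abs_mult mult.commute)
  qed
qed measurable

lemma integral_J_mult_le:
  assumes "w \<in> borel_measurable lebesgue" "AE y in lebesgue. \<bar>w y\<bar> \<le> K"
    and "AE y in lebesgue. w y \<le> c"
  shows "(LINT y|lebesgue. J (x - y) * w y) \<le> c"
proof -
  have "(LINT y|lebesgue. J (x - y) * w y) \<le> (LINT y|lebesgue. J (x - y) * c)"
  proof (rule integral_mono_AE)
    show "AE y in lebesgue. J (x - y) * w y \<le> J (x - y) * c"
      using assms(3) by eventually_elim (simp add: mult_left_mono J_nonneg)
  qed (intro integrable_J_mult[OF assms(1,2)] integrable_mult_left integrable_J_translate)+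
  then show ?thesis
    by (simp add: integral_J_translate)
qed

text \<open>Real-valued, because the equation is differentiated in the reals. For a bounded datum
  the iterates are finite, so \<open>enn2real\<close> loses nothing; see
  \<open>iterate_eq\<close>.\<close>

definition iterate :: "('a \<Rightarrow> real) \<Rightarrow> nat \<Rightarrow> 'a \<Rightarrow> real" where
  "iterate v n x = enn2real ((nn_conv (\<lambda>z. ennreal (J z)) ^^ n) (\<lambda>y. ennreal (v y)) x)"

context
  fixes v :: "'a \<Rightarrow> real" and V :: real
  assumes v_measurable [measurable]: "v \<in> borel_measurable borel"
    and v_nonneg: "\<And>y. 0 \<le> v y" and v_le: "\<And>y. v y \<le> V"
begin

lemma V_nonneg: "0 \<le> V"
  using v_nonneg v_le order_trans by blast

lemma iterate_eq:
  "ennreal (iterate v n x) = (nn_conv (\<lambda>z. ennreal (J z)) ^^ n) (\<lambda>y. ennreal (v y)) x"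
  and iterate_nonneg: "0 \<le> iterate v n x" and iterate_le: "iterate v n x \<le> V"
proof -
  have le: "(nn_conv (\<lambda>z. ennreal (J z)) ^^ n) (\<lambda>y. ennreal (v y)) x \<le> ennreal V"
    using nn_conv_pow_le_sup[of "\<lambda>z. ennreal (J z)" "\<lambda>y. ennreal (v y)" "ennreal V" n x]
    by (simp add: J_integral v_le ennreal_leI)
  then show eq: "ennreal (iterate v n x) = (nn_conv (\<lambda>z. ennreal (J z)) ^^ n) (\<lambda>y. ennreal (v y)) x"
    unfolding iterate_def by (intro ennreal_enn2real) (auto intro: le_less_trans simp: ennreal_less_top)
  show "0 \<le> iterate v n x"
    by (simp add: iterate_def)
  show "iterate v n x \<le> V"
    using le unfolding eq[symmetric] by (simp add: ennreal_le_iff V_nonneg)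
qed

lemma iterate_0: "iterate v 0 x = v x"
  by (simp add: iterate_def v_nonneg)

lemma iterate_measurable [measurable]: "iterate v n \<in> borel_measurable lebesgue"
proof (rule measurable_completion)
  show "iterate v n \<in> borel_measurable lborel"
    unfolding iterate_def[abs_def] by measurable
qed

lemma iterate_Suc: "iterate v (Suc n) x = (LINT y|lebesgue. J (x - y) * iterate v n y)"
proof -
  have "(LINT y|lebesgue. J (x - y) * iterate v n y)
      = enn2real (\<integral>\<^sup>+ y. ennreal (J (x - y) * iterate v n y) \<partial>lebesgue)"
    by (rule integral_eq_nn_integral) (auto simp: J_nonneg iterate_nonneg)
  also have "(\<integral>\<^sup>+ y. ennreal (J (x - y) * iterate v n y) \<partial>lebesgue)
      = nn_conv (\<lambda>z. ennreal (J z)) (\<lambda>y. ennreal (iterate v n y)) x"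
    by (simp add: nn_integral_completion nn_conv_def ennreal_mult J_nonneg iterate_nonneg)
  finally show ?thesis
    by (simp add: iterate_eq) (simp add: iterate_def)
qed

definition partial_sum :: "nat \<Rightarrow> real \<Rightarrow> 'a \<Rightarrow> real" where
  "partial_sum n t x = (\<Sum>i<n. t ^ i / fact i * iterate v i x)"

lemma partial_sum_measurable [measurable]: "partial_sum n t \<in> borel_measurable lebesgue"
  unfolding partial_sum_def[abs_def] by measurable

lemma partial_sum_bounds:
  assumes "0 \<le> t"
  shows "0 \<le> partial_sum n t x" "partial_sum n t x \<le> exp t * V"
proof -
  show "0 \<le> partial_sum n t x"
    unfolding partial_sum_def using assms iterate_nonneg by (intro sum_nonneg) auto
  have "partial_sum n t x \<le> (\<Sum>i<n. t ^ i / fact i) * V"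
    unfolding partial_sum_def sum_distrib_right using assms by (intro sum_mono mult_left_mono iterate_le) auto
  also have "\<dots> \<le> exp t * V"
    using assms V_nonneg by (intro mult_right_mono sum_le_exp) auto
  finally show "partial_sum n t x \<le> exp t * V" .
qed

lemma partial_sum_eq:
  assumes "0 \<le> t"
  shows "ennreal (partial_sum n t x) = exp_sum n t (\<lambda>z. ennreal (J z)) (\<lambda>y. ennreal (v y)) x"
proof -
  have "ennreal (t ^ i / fact i * iterate v i x)
      = ennreal (t ^ i / fact i) * (nn_conv (\<lambda>z. ennreal (J z)) ^^ i) (\<lambda>y. ennreal (v y)) x" for i
    using assms by (subst ennreal_mult) (simp_all add: iterate_nonneg iterate_eq)
  then show ?thesis
    using assms unfolding partial_sum_def exp_sum_def
    by (subst sum_ennreal[symmetric]) (auto simp: iterate_nonneg)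
qed

text \<open>For w = exp(t) u the equation reads w' = J * w, and the partial sums are its Picard
  iterates.\<close>

lemma has_real_derivative_partial_sum:
  "((\<lambda>t. partial_sum (Suc n) t x) has_real_derivative (LINT y|lebesgue. J (x - y) * partial_sum n t y)) (at t)"
proof -
  have int: "integrable lebesgue (\<lambda>y. J (x - y) * iterate v i y)" for i
    by (rule integrable_J_mult[of _ V]) (auto simp: iterate_nonneg iterate_le)
  have "(LINT y|lebesgue. J (x - y) * partial_sum n t y)
      = (LINT y|lebesgue. (\<Sum>i<n. t ^ i / fact i * (J (x - y) * iterate v i y)))"
    by (simp add: partial_sum_def sum_distrib_left mult_ac)
  also have "\<dots> = (\<Sum>i<n. t ^ i / fact i * iterate v (Suc i) x)"
    by (subst Bochner_Integration.integral_sum) (auto simp: int iterate_Suc)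
  finally have *: "(LINT y|lebesgue. J (x - y) * partial_sum n t y) = (\<Sum>i<n. t ^ i / fact i * iterate v (Suc i) x)" .
  show ?thesis
    unfolding * unfolding partial_sum_def by (rule has_real_derivative_exp_partial_sum)
qed

text \<open>An upper bound of order \<open>n\<close> for the error, valid for each time at almost every point, improves to one of
  order \<^term>\<open>Suc n\<close> by integrating the equation in time at a fixed point; a lower bound is not needed.\<close>

lemma nonlocal_solution_error:
  assumes sol: "nonlocal_solution J u0 u" and u0: "AE x in lebesgue. u0 x = v x"
    and T: "0 \<le> T" and K: "\<And>t. t \<in> {0..T} \<Longrightarrow> AE x in lebesgue. \<bar>u x t\<bar> \<le> K" "0 \<le> K"
  shows "(\<forall>t\<in>{0..T}. AE x in lebesgue. exp t * u x t - partial_sum n t x \<le> exp T * K * (t ^ n / fact n))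
    \<and> (AE x in lebesgue. \<forall>t\<in>{0..T}. exp t * u x t - partial_sum (Suc n) t x \<le> exp T * K * (t ^ Suc n / fact (Suc n)))"
proof -
  have meas [measurable]: "\<And>t. 0 \<le> t \<Longrightarrow> (\<lambda>x. u x t) \<in> borel_measurable lebesgue"
    and reg: "AE x in lebesgue. u x 0 = u0 x \<and> continuous_on {0..} (u x) \<and>
        (\<forall>t>0. (u x has_real_derivative (LINT y|lebesgue. J (x - y) * (u y t - u x t))) (at t))"
    using sol unfolding nonlocal_solution_def by blast+
  \<comment> \<open>The null set in the hypothesis may vary with t, as the hypothesis is only
    integrated over y. The null set of the conclusion comes from \<open>reg\<close> and
    \<open>u0\<close> and serves all t.\<close>
  have step: "AE x in lebesgue. \<forall>t\<in>{0..T}. exp t * u x t - partial_sum (Suc n) t x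
        \<le> exp T * K * (t ^ Suc n / fact (Suc n))"
    if IH: "\<forall>t\<in>{0..T}. AE x in lebesgue. exp t * u x t - partial_sum n t x \<le> exp T * K * (t ^ n / fact n)" for n
    using reg u0
  proof eventually_elim
    case (elim x)
    then have x0: "u x 0 = v x" and cont: "continuous_on {0..} (u x)"
      and deriv: "\<And>t. 0 < t \<Longrightarrow> (u x has_real_derivative (LINT y|lebesgue. J (x - y) * (u y t - u x t))) (at t)"
      by auto
    \<comment> \<open>The function vanishes at 0, and its derivative is J convolved with the error
      of order n, minus the derivative of the bound, hence nonpositive.\<close>
    define \<phi> where "\<phi> t = exp t * u x t - partial_sum (Suc n) t x - exp T * K * (t ^ Suc n / fact (Suc n))" for t
    have \<phi>0: "\<phi> 0 = 0"
      by (simp add: \<phi>_def x0 partial_sum_def iterate_0 lessThan_Suc_eq_insert_0 sum.reindex)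
    show ?case
    proof
      fix t assume t: "t \<in> {0..T}"
      have "\<phi> t \<le> \<phi> 0"
      proof (rule DERIV_nonpos_imp_decreasing_open[where f = \<phi> and a = 0 and b = t])
        show "0 \<le> t" using t by simp
        have "continuous_on {0..t} (\<lambda>t. partial_sum (Suc n) t x)"
          by (rule continuous_at_imp_continuous_on) (blast intro: DERIV_isCont has_real_derivative_partial_sum)
        moreover have "continuous_on {0..t} (u x)"
          using cont by (rule continuous_on_subset) auto
        ultimately show "continuous_on {0..t} \<phi>"
          unfolding \<phi>_def[abs_def] by (intro continuous_intros) auto
      next
        fix s assume s: "0 < s" "s < t"
        let ?I = "\<lambda>w. LINT y|lebesgue. J (x - y) * w y"
        have sT: "s \<in> {0..T}" using s t by auto
        have s0: "0 \<le> s" using s by simp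
        have intu: "integrable lebesgue (\<lambda>y. J (x - y) * u y s)"
          by (rule integrable_J_mult[OF meas[OF s0] K(1)[OF sT]])
        have intp: "integrable lebesgue (\<lambda>y. J (x - y) * partial_sum n s y)"
          using partial_sum_bounds[OF s0] by (intro integrable_J_mult[of _ "exp s * V"]) auto
        have "?I (\<lambda>y. u y s - u x s) = ?I (\<lambda>y. u y s) - u x s"
          using intu integrable_J_translate[of x]
          by (simp add: right_diff_distrib integral_J_translate)
        then have du: "(u x has_real_derivative ?I (\<lambda>y. u y s) - u x s) (at s)"
          using deriv[OF s(1)] by simp
        have dR: "((\<lambda>t. exp T * K * (t ^ Suc n / fact (Suc n))) has_real_derivative exp T * K * (s ^ n / fact n)) (at s)"
        proof -
          have "((\<lambda>t. exp T * K * (t ^ Suc n / fact (Suc n))) has_real_derivative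
            exp T * K * (real (Suc n) * s ^ n / fact (Suc n))) (at s)"
            by (rule derivative_eq_intros refl | simp)+
          then show ?thesis
            by (simp only: Suc_mult_power_div_fact)
        qed
        let ?d = "exp s * u x s + (?I (\<lambda>y. u y s) - u x s) * exp s - ?I (partial_sum n s) - exp T * K * (s ^ n / fact n)"
        have "(\<phi> has_real_derivative ?d) (at s)"
          unfolding \<phi>_def[abs_def]
          by (intro DERIV_diff DERIV_mult DERIV_exp du dR has_real_derivative_partial_sum)
        moreover have "?d \<le> 0"
        proof -
          \<comment> \<open>The derivative of the factor exp(s) cancels the term -u of the
            equation.\<close>
          have "?d = exp s * ?I (\<lambda>y. u y s) - ?I (partial_sum n s) - exp T * K * (s ^ n / fact n)"
            by (simp add: algebra_simps)
          also have "exp s * ?I (\<lambda>y. u y s) - ?I (partial_sum n s) = ?I (\<lambda>y. exp s * u y s - partial_sum n s y)"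
            using intu intp by (simp add: right_diff_distrib mult.left_commute[of _ "exp s"])
          also have "\<dots> \<le> exp T * K * (s ^ n / fact n)"
          proof (rule integral_J_mult_le)
            show "AE y in lebesgue. \<bar>exp s * u y s - partial_sum n s y\<bar> \<le> exp s * K + exp s * V"
              using K(1)[OF sT]
            proof eventually_elim
              case (elim y)
              have "\<bar>exp s * u y s\<bar> \<le> exp s * K"
                using elim by (simp add: abs_mult)
              moreover have "\<bar>partial_sum n s y\<bar> \<le> exp s * V"
                using partial_sum_bounds[OF s0, of n y] by simp
              ultimately show ?case by linarith
            qed
            show "AE y in lebesgue. exp s * u y s - partial_sum n s y \<le> exp T * K * (s ^ n / fact n)"
              using IH sT by blast
            show "(\<lambda>y. exp s * u y s - partial_sum n s y) \<in> borel_measurable lebesgue"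
              using meas[OF s0] by measurable
          qed
          finally show ?thesis by simp
        qed
        ultimately show "\<exists>y. DERIV \<phi> s :> y \<and> y \<le> 0" by blast
      qed
      then show "exp t * u x t - partial_sum (Suc n) t x \<le> exp T * K * (t ^ Suc n / fact (Suc n))"
        unfolding \<phi>0 by (simp add: \<phi>_def)
    qed
  qed
  show ?thesis
  proof (induction n)
    case 0
    have *: "\<forall>t\<in>{0..T}. AE x in lebesgue. exp t * u x t - partial_sum 0 t x \<le> exp T * K * (t ^ 0 / fact 0)"
    proof
      fix t assume t: "t \<in> {0..T}"
      show "AE x in lebesgue. exp t * u x t - partial_sum 0 t x \<le> exp T * K * (t ^ 0 / fact 0)"
        using K(1)[OF t]
      proof eventually_elim
        case (elim x)
        have "exp t * u x t \<le> exp t * K" using elim by simp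
        also have "\<dots> \<le> exp T * K" using t K(2) by (intro mult_right_mono) auto
        finally show ?case by (simp add: partial_sum_def)
      qed
    qed
    show ?case
      using * step[OF *] by blast
  next
    case (Suc n)
    have *: "\<forall>t\<in>{0..T}. AE x in lebesgue. exp t * u x t - partial_sum (Suc n) t x \<le> exp T * K * (t ^ Suc n / fact (Suc n))"
    proof
      fix t assume t: "t \<in> {0..T}"
      from Suc[THEN conjunct2]
      show "AE x in lebesgue. exp t * u x t - partial_sum (Suc n) t x \<le> exp T * K * (t ^ Suc n / fact (Suc n))"
        by eventually_elim (use t in blast)
    qed
    show ?case
      using * step[OF *] by blast
  qed
qed

text \<open>The error t^(n+1) / (n+1)! vanishes as n grows, so a common bound on all partial sums
  passes to u. This is the form in which every later estimate reaches the solution.\<close>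

lemma nonlocal_solution_le:
  assumes sol: "nonlocal_solution J u0 u" and u0: "AE x in lebesgue. u0 x = v x"
  shows "AE x in lebesgue. \<forall>t>0. \<forall>U\<ge>0.
      (\<forall>m. ennreal (exp (- t)) * exp_sum m t (\<lambda>z. ennreal (J z)) (\<lambda>y. ennreal (v y)) x \<le> ennreal U)
      \<longrightarrow> u x t \<le> U"
proof -
  \<comment> \<open>Restricting T to natural numbers leaves countably many null sets, indexed by T
    and n, so one null set serves all times.\<close>
  have "\<forall>T. \<exists>R. \<forall>n. AE x in lebesgue. \<forall>t\<in>{0..real T}. exp t * u x t - partial_sum (Suc n) t x \<le> R * (t ^ Suc n / fact (Suc n))"
  proof
    fix T :: nat
    obtain K where "\<forall>t\<in>{0..real T}. AE x in lebesgue. \<bar>u x t\<bar> \<le> K"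
      using sol unfolding nonlocal_solution_def by (meson of_nat_0_le_iff)
    then have "AE x in lebesgue. \<bar>u x t\<bar> \<le> \<bar>K\<bar>" if "t \<in> {0..real T}" for t
      using that by (metis (mono_tags, lifting) AE_mp AE_I2 abs_ge_self order_trans)
    then have "\<forall>n. AE x in lebesgue. \<forall>t\<in>{0..real T}. exp t * u x t - partial_sum (Suc n) t x
        \<le> exp (real T) * \<bar>K\<bar> * (t ^ Suc n / fact (Suc n))"
      by (intro allI nonlocal_solution_error[OF sol u0, THEN conjunct2]) auto
    then show "\<exists>R. \<forall>n. AE x in lebesgue. \<forall>t\<in>{0..real T}. exp t * u x t - partial_sum (Suc n) t x \<le> R * (t ^ Suc n / fact (Suc n))"
      by blast
  qed
  from choice[OF this] obtain R where R: "\<And>T n. AE x in lebesgue. \<forall>t\<in>{0..real T}. exp t * u x t - partial_sum (Suc n) t x \<le> R T * (t ^ Suc n / fact (Suc n))"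
    by blast
  have "AE x in lebesgue. \<forall>T n. \<forall>t\<in>{0..real T}. exp t * u x t - partial_sum (Suc n) t x \<le> R T * (t ^ Suc n / fact (Suc n))"
    unfolding AE_all_countable using R by blast
  then show ?thesis
  proof eventually_elim
    case (elim x)
    show ?case
    proof (intro allI impI)
      fix t U :: real
      assume t: "0 < t" and U: "0 \<le> U"
        and le: "\<forall>m. ennreal (exp (- t)) * exp_sum m t (\<lambda>z. ennreal (J z)) (\<lambda>y. ennreal (v y)) x \<le> ennreal U"
      obtain T :: nat where T: "t \<le> real T" using real_arch_simple by blast
      have "u x t \<le> U + exp (- t) * R T * (t ^ Suc n / fact (Suc n))" for n
      proof -
        have "ennreal (exp (- t) * partial_sum (Suc n) t x) \<le> ennreal U"
          using le t partial_sum_bounds(1)[of t "Suc n" x] by (simp add: ennreal_mult partial_sum_eq)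
        then have "exp (- t) * partial_sum (Suc n) t x \<le> U"
          using U by (simp add: ennreal_le_iff)
        moreover have "exp t * u x t \<le> partial_sum (Suc n) t x + R T * (t ^ Suc n / fact (Suc n))"
          using elim[rule_format, of t T n] t T by simp
        then have "exp (- t) * (exp t * u x t) \<le> exp (- t) * (partial_sum (Suc n) t x + R T * (t ^ Suc n / fact (Suc n)))"
          by (rule mult_left_mono) simp
        moreover have "exp (- t) * (exp t * u x t) = u x t"
          by (simp add: mult.assoc[symmetric] exp_add[symmetric])
        ultimately show ?thesis
          by (simp add: distrib_left mult.assoc)
      qed
      moreover have "(\<lambda>n. U + exp (- t) * R T * (t ^ Suc n / fact (Suc n))) \<longlonglongrightarrow> U + exp (- t) * R T * 0"
      proof (intro tendsto_intros)
        have "(\<lambda>n. t ^ n / fact n) \<longlonglongrightarrow> 0"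
          using summable_LIMSEQ_zero[OF summable_exp[of t]] by (simp add: divide_inverse mult.commute)
        then show "(\<lambda>n. t ^ Suc n / fact (Suc n)) \<longlonglongrightarrow> 0"
          by (rule LIMSEQ_Suc)
      qed
      ultimately show "u x t \<le> U"
        using LIMSEQ_le_const[of _ "U + exp (- t) * R T * 0" "u x t"] by auto
    qed
  qed
qed

end

end

section \<open>Weighted bounds\<close>

lemma nn_conv_add_right:
  fixes k v w :: "'a::euclidean_space \<Rightarrow> ennreal"
  assumes [measurable]: "k \<in> borel_measurable borel" "v \<in> borel_measurable borel"
    "w \<in> borel_measurable borel"
  shows "nn_conv k (\<lambda>x. v x + w x) = (\<lambda>x. nn_conv k v x + nn_conv k w x)"
  by (simp add: fun_eq_iff nn_conv_def distrib_left nn_integral_add)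

lemma exp_sum_add_right:
  fixes k v w :: "'a::euclidean_space \<Rightarrow> ennreal"
  assumes [measurable]: "k \<in> borel_measurable borel" "v \<in> borel_measurable borel"
    "w \<in> borel_measurable borel"
  shows "exp_sum m t k (\<lambda>x. v x + w x) x = exp_sum m t k v x + exp_sum m t k w x"
proof -
  have "(nn_conv k ^^ n) (\<lambda>x. v x + w x) = (\<lambda>x. (nn_conv k ^^ n) v x + (nn_conv k ^^ n) w x)" for n
    by (induction n) (simp_all add: nn_conv_add_right)
  then show ?thesis
    by (simp add: exp_sum_def distrib_left sum.distrib)
qed

text \<open>A single term of the series of exp(w z) is at most the whole.\<close>

lemma power_mult_exp_neg_le:
  fixes w z :: real
  assumes "0 < w" "0 \<le> z"
  shows "z ^ n * exp (- w * z) \<le> fact n / w ^ n"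
proof -
  have "(\<Sum>i<Suc n. (w * z) ^ i / fact i) \<le> exp (w * z)"
    using assms by (intro sum_le_exp) simp
  moreover have "(w * z) ^ n / fact n \<le> (\<Sum>i<Suc n. (w * z) ^ i / fact i)"
    using assms by (intro member_le_sum) auto
  ultimately have "(w * z) ^ n / fact n \<le> exp (w * z)" by linarith
  then have "(w * z) ^ n / fact n * exp (- w * z) \<le> exp (w * z) * exp (- w * z)"
    by (rule mult_right_mono) simp
  also have "\<dots> = 1"
    by (simp add: exp_add[symmetric])
  finally show ?thesis
    using assms by (simp add: power_mult_distrib field_simps)
qed

context minorized_kernel
begin

text \<open>The summands account for small radii, the unsmoothed term, the smoothed inner mass and
  the outer part. \<open>P\<close> bounds t^N exp(-minorant t), \<open>Q\<close> bounds z^N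
  exp(-z/2), and \<open>a1\<close>, \<open>a2\<close> are the coefficients in f(k) \<le> a1 + a2
  k^N.\<close>

definition bound_const :: "real \<Rightarrow> real \<Rightarrow> real \<Rightarrow> real \<Rightarrow> real \<Rightarrow> real" where
  "bound_const a1 a2 V k0 E =
    (let N = DIM('a); P = fact N / minorant ^ N; Q = fact N * 2 ^ N in
     exp rate * V * (a1 + a2 * max k0 1 ^ N) + exp rate * V * (a1 + a2 * (P + Q + P * Q))
     + exp rate * decay_const * (1 + Q) + E)"

context
  fixes v :: "'a \<Rightarrow> real" and V :: real
  assumes v_measurable [measurable]: "v \<in> borel_measurable borel"
    and v_nonneg: "\<And>y. 0 \<le> v y" and v_le: "\<And>y. v y \<le> V"
begin

text \<open>The series of J times exp(-t) does not increase a sup norm, so the part of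
  \<open>v\<close> outside the ball adds at most \<open>c\<close>. Inside the ball l . y \<le> |l|
  s, and the tilted estimates apply.\<close>

lemma exp_sum_near_far:
  assumes mass: "(\<integral>\<^sup>+ y. ennreal (v y) * indicator (ball 0 s) y \<partial>lborel) \<le> ennreal \<mu>" "0 \<le> \<mu>"
    and far: "\<And>y. s \<le> norm y \<Longrightarrow> v y \<le> c" "0 \<le> c"
    and l: "norm l \<le> 1" "t * (norm l)\<^sup>2 \<le> 1" and t: "t > 0"
  shows "ennreal (exp (- t)) * exp_sum m t (\<lambda>z. ennreal (J z)) (\<lambda>y. ennreal (v y)) x
      \<le> ennreal (exp (rate + norm l * s - l \<bullet> x) * (exp (- minorant * t) * V + decay_const / sqrt t ^ DIM('a) * \<mu>) + c)" (is ?A)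
    and "ennreal (exp (- t)) * exp_sum m t (\<lambda>z. ennreal (J z)) (\<lambda>y. ennreal (v y)) x
      \<le> ennreal (exp (rate + norm l * s - l \<bullet> x) * V + c)" (is ?B)
proof -
  let ?J = "\<lambda>z. ennreal (J z)"
  define v1 where "v1 y = ennreal (v y) * indicator (ball 0 s) y" for y
  define v2 where "v2 y = ennreal (v y) * indicator (- ball 0 s) y" for y
  have [measurable]: "v1 \<in> borel_measurable borel" "v2 \<in> borel_measurable borel"
    unfolding v1_def[abs_def] v2_def[abs_def]
    by (intro borel_measurable_times_ennreal borel_measurable_indicator; simp)+
  have V0: "0 \<le> V" using v_nonneg v_le order_trans by blast
  have v12: "(\<lambda>y. ennreal (v y)) = (\<lambda>y. v1 y + v2 y)"
    by (auto simp: fun_eq_iff v1_def v2_def indicator_def)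
  have "exp_sum m t ?J v2 x \<le> ennreal (exp (t * 1)) * ennreal c"
    using t far J_integral
    by (intro exp_sum_le_sup) (auto simp: v2_def indicator_def not_less intro!: ennreal_leI)
  then have "ennreal (exp (- t)) * exp_sum m t ?J v2 x \<le> ennreal (exp (- t)) * (ennreal (exp t) * ennreal c)"
    by (intro mult_left_mono) auto
  also have "\<dots> = ennreal c"
    by (simp add: mult.assoc[symmetric] ennreal_mult[symmetric] exp_add[symmetric])
  finally have two: "ennreal (exp (- t)) * exp_sum m t ?J v2 x \<le> ennreal c" .
  have v1V: "v1 y \<le> ennreal V" for y
    using v_le[of y] by (auto simp: v1_def indicator_def ennreal_leI)
  have b: "l \<bullet> y \<le> norm l * s" if "v1 y \<noteq> 0" for y
  proof -
    have "norm y < s" using that by (auto simp: v1_def indicator_def split: if_splits)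
    then have "norm l * norm y \<le> norm l * s" by (intro mult_left_mono) auto
    then show ?thesis using norm_cauchy_schwarz[of l y] by linarith
  qed
  note near = exp_sum_J_le[where m = m and x = x, OF _ l(1) t l(2) v1V V0 b]
  have "ennreal (exp (- t)) * exp_sum m t ?J v1 x
      \<le> ennreal (exp (rate + norm l * s - l \<bullet> x)) *
         (ennreal (exp (- minorant * t) * V) + ennreal (decay_const / sqrt t ^ DIM('a)) * (\<integral>\<^sup>+ y. v1 y \<partial>lborel))"
    by (rule near(1)) auto
  also have "\<dots> \<le> ennreal (exp (rate + norm l * s - l \<bullet> x)) *
         (ennreal (exp (- minorant * t) * V) + ennreal (decay_const / sqrt t ^ DIM('a)) * ennreal \<mu>)"
    using mass(1) by (intro mult_left_mono add_mono) (auto simp: v1_def)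
  also have "\<dots> = ennreal (exp (rate + norm l * s - l \<bullet> x) * (exp (- minorant * t) * V + decay_const / sqrt t ^ DIM('a) * \<mu>))"
  proof -
    have d: "0 \<le> decay_const / sqrt t ^ DIM('a)"
      using decay_const_pos t by simp
    have "ennreal (decay_const / sqrt t ^ DIM('a)) * ennreal \<mu> = ennreal (decay_const / sqrt t ^ DIM('a) * \<mu>)"
      using d mass(2) by (rule ennreal_mult[symmetric])
    moreover have "ennreal (exp (- minorant * t) * V) + ennreal (decay_const / sqrt t ^ DIM('a) * \<mu>)
      = ennreal (exp (- minorant * t) * V + decay_const / sqrt t ^ DIM('a) * \<mu>)"
      using V0 mult_nonneg_nonneg[OF d mass(2)] by (intro ennreal_plus[symmetric]) auto
    moreover have "0 \<le> exp (- minorant * t) * V + decay_const / sqrt t ^ DIM('a) * \<mu>"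
      using V0 mult_nonneg_nonneg[OF d mass(2)] by (intro add_nonneg_nonneg) auto
    ultimately show ?thesis
      by (simp only: ennreal_mult[symmetric] exp_ge_zero)
  qed
  finally have one: "ennreal (exp (- t)) * exp_sum m t ?J v1 x
      \<le> ennreal (exp (rate + norm l * s - l \<bullet> x) * (exp (- minorant * t) * V + decay_const / sqrt t ^ DIM('a) * \<mu>))" .
  have split: "ennreal (exp (- t)) * exp_sum m t ?J (\<lambda>y. ennreal (v y)) x
      = ennreal (exp (- t)) * exp_sum m t ?J v1 x + ennreal (exp (- t)) * exp_sum m t ?J v2 x"
    unfolding v12 by (subst exp_sum_add_right) (auto simp: distrib_left)
  show ?A
    unfolding split using add_mono[OF one two] V0 far(2) mass(2) decay_const_pos t
    by (subst ennreal_plus) (auto intro!: mult_nonneg_nonneg add_nonneg_nonneg)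
  have "ennreal (exp (- t)) * exp_sum m t ?J v1 x \<le> ennreal (exp (rate + norm l * s - l \<bullet> x) * V)"
    by (rule near(2)) auto
  from add_mono[OF this two] show ?B
    unfolding split using V0 far(2) by (subst ennreal_plus) auto
qed

text \<open>\<open>U\<close> plays the value of the solution at (x, t), known only through the
  bounds it inherits from the series; \<open>f\<close> and \<open>mass\<close> play the mass ratio
  and the mass of balls.\<close>

lemma weighted_bounds:
  fixes f mass :: "real \<Rightarrow> real" and U :: real
  assumes mass: "\<And>k. ennreal (mass k) = (\<integral>\<^sup>+ y. ennreal (v y) * indicator (ball 0 k) y \<partial>lborel)"
    and mass_nonneg: "\<And>k. 0 \<le> mass k" and mass_pos: "\<And>k. 0 < k \<Longrightarrow> 0 < mass k"
    and f: "\<And>k. f k = k ^ DIM('a) / mass k"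
    and f_le: "\<And>k. 0 \<le> k \<Longrightarrow> f k \<le> a1 + a2 * k ^ DIM('a)" and a: "0 \<le> a1" "0 \<le> a2"
    and comparable: "\<And>k l. k0 \<le> k \<Longrightarrow> k \<le> 2 * l \<Longrightarrow> f k \<le> D * f l" and D: "0 \<le> D"
    and decay: "\<And>y. f (norm y) * v y \<le> B" and B: "0 \<le> B" and t: "0 < t"
    and U: "\<And>c. 0 \<le> c \<Longrightarrow> (\<And>m. ennreal (exp (- t)) * exp_sum m t (\<lambda>z. ennreal (J z)) (\<lambda>y. ennreal (v y)) x \<le> ennreal c) \<Longrightarrow> U \<le> c"
  shows "U \<le> exp rate * V" and "f (sqrt t) * U \<le> bound_const a1 a2 V k0 (D * B)"
    and "f (norm x) * U \<le> bound_const a1 a2 V k0 (D * B)"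
proof -
  define N where "N = DIM('a)"
  define w where "w = minorant"
  have w: "0 < w" using minorant_pos by (simp add: w_def)
  define P where "P = fact N / w ^ N"
  define Q :: real where "Q = fact N * 2 ^ N"
  have PQ: "0 \<le> P" "0 \<le> Q" using w by (auto simp: P_def Q_def)
  have V0: "0 \<le> V" using v_nonneg v_le order_trans by blast
  define e where "e = exp rate"
  have e: "0 < e" by (simp add: e_def)
  define d where "d = decay_const"
  have d: "0 < d" using decay_const_pos by (simp add: d_def)
  define C where "C = bound_const a1 a2 V k0 (D * B)"
  have C: "C = e * V * (a1 + a2 * max k0 1 ^ N) + e * V * (a1 + a2 * (P + Q + P * Q)) + e * d * (1 + Q) + D * B"
    by (simp add: C_def bound_const_def Let_def N_def P_def Q_def w_def e_def d_def)
  have parts: "0 \<le> e * V * (a1 + a2 * max k0 1 ^ N)" "0 \<le> e * V * (a1 + a2 * (P + Q + P * Q))"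
    "0 \<le> e * d * (1 + Q)" "0 \<le> D * B"
    using e d V0 a PQ D B by auto
  have f_nonneg: "0 \<le> f k" if "0 \<le> k" for k
    using that mass_nonneg by (simp add: f)
  have f_pos: "0 < f k" if "0 < k" for k
    using that mass_pos by (simp add: f)
  \<comment> \<open>Comparability carries the decay from radius |y| to every k \<le> 2 |y|; the
    factor 2 makes room for splitting at k/2.\<close>
  have far: "v y \<le> D * B / f k" if "max k0 1 \<le> k" "k \<le> 2 * norm y" for k y
  proof -
    have "v y * f k \<le> v y * (D * f (norm y))"
      using that by (intro mult_left_mono comparable v_nonneg) auto
    also have "\<dots> \<le> D * B"
      using mult_left_mono[OF decay[of y] D] by (simp add: mult_ac)
    finally show ?thesis
      using f_pos[of k] that by (simp add: le_divide_eq)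
  qed
  have near_far: "U \<le> exp (rate + norm l * s - l \<bullet> x) * (exp (- w * t) * V + d / sqrt t ^ N * mass s) + c"
      "U \<le> exp (rate + norm l * s - l \<bullet> x) * V + c"
    if "\<And>y. s \<le> norm y \<Longrightarrow> v y \<le> c" "0 \<le> c" "norm l \<le> 1" "t * (norm l)\<^sup>2 \<le> 1" for l s c
    using that t V0 d mass_nonneg[of s] unfolding w_def d_def N_def
    by (intro U exp_sum_near_far; force simp: mass[symmetric])+
  have UV: "U \<le> e * V"
  proof (rule U)
    fix m
    have "ennreal (exp (- t)) * exp_sum m t (\<lambda>z. ennreal (J z)) (\<lambda>y. ennreal (v y)) x
        \<le> ennreal (exp (rate + 0 - 0 \<bullet> x) * V)"
      using t V0 v_le by (intro exp_sum_J_le) (auto simp: ennreal_leI)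
    then show "ennreal (exp (- t)) * exp_sum m t (\<lambda>z. ennreal (J z)) (\<lambda>y. ennreal (v y)) x \<le> ennreal (e * V)"
      by (simp add: e_def)
  qed (use e V0 in simp)
  then show "U \<le> exp rate * V" by (simp add: e_def)
  have small: "f k * U \<le> C" if "0 \<le> k" "k \<le> max k0 1" for k
  proof -
    have "f k * U \<le> f k * (e * V)"
      using UV f_nonneg[OF that(1)] by (rule mult_left_mono)
    also have "\<dots> \<le> (a1 + a2 * max k0 1 ^ N) * (e * V)"
    proof (rule mult_right_mono)
      have "k ^ N \<le> max k0 1 ^ N" using that by (intro power_mono)
      then have "a2 * k ^ N \<le> a2 * max k0 1 ^ N" using a(2) by (rule mult_left_mono)
      then show "f k \<le> a1 + a2 * max k0 1 ^ N"
        using f_le[OF that(1)] by (simp add: N_def)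
    qed (use e V0 in simp)
    also have "\<dots> = e * V * (a1 + a2 * max k0 1 ^ N)" by simp
    also have "\<dots> \<le> C" unfolding C using parts by linarith
    finally show ?thesis .
  qed
  \<comment> \<open>For t \<ge> 1 the root is at most t, which permits the integer power N of
    t.\<close>
  have time_decay: "sqrt t ^ N * exp (- w * t) \<le> P" if "1 \<le> t"
  proof -
    have "sqrt t \<le> t"
      using that real_sqrt_le_mono[of t "t * t"] by (simp add: mult_le_cancel_left1)
    then have "sqrt t ^ N * exp (- w * t) \<le> t ^ N * exp (- w * t)"
      using t by (intro mult_right_mono power_mono) auto
    also have "\<dots> \<le> P"
      unfolding P_def using w t by (intro power_mult_exp_neg_le) auto
    finally show ?thesis .
  qed
  show "f (sqrt t) * U \<le> bound_const a1 a2 V k0 (D * B)"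
  proof (cases "sqrt t \<le> max k0 1")
    case True
    then show ?thesis
      using small[of "sqrt t"] t by (simp add: C_def)
  next
    case False
    define k where "k = sqrt t"
    have k: "max k0 1 \<le> k" "1 \<le> k" "0 < k" using False unfolding k_def by linarith+
    have t1: "1 \<le> t" using k(2) by (simp add: k_def)
    \<comment> \<open>No tilt, and the datum is split at radius sqrt t.\<close>
    have "U \<le> exp (rate + norm (0::'a) * k - 0 \<bullet> x) * (exp (- w * t) * V + d / sqrt t ^ N * mass k) + D * B / f k"
    proof (rule near_far(1))
      show "v y \<le> D * B / f k" if "k \<le> norm y" for y
        using that k by (intro far) auto
      show "0 \<le> D * B / f k"
        using D B f_pos[OF k(3)] by simp
    qed (use t in auto)
    then have "U \<le> e * (exp (- w * t) * V + d / k ^ N * mass k) + D * B / f k"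
      by (simp add: e_def k_def)
    then have "f k * U \<le> f k * (e * (exp (- w * t) * V + d / k ^ N * mass k) + D * B / f k)"
      using f_pos[OF k(3)] by (intro mult_left_mono) auto
    also have "\<dots> = e * V * (f k * exp (- w * t)) + e * d * (f k * mass k / k ^ N) + D * B"
      using f_pos[OF k(3)] by (simp add: algebra_simps)
    \<comment> \<open>The mass of this ball is k^N / f(k), and k^N = t^(N/2) is exactly what the
      smoothing provides.\<close>
    also have "f k * mass k / k ^ N = 1"
      using mass_pos[OF k(3)] k(3) by (simp add: f N_def)
    also have "e * V * (f k * exp (- w * t)) + e * d * 1 + D * B
        \<le> e * V * (a1 + a2 * (P + Q + P * Q)) + e * d * (1 + Q) + D * B"
    proof -
      have "f k * exp (- w * t) \<le> (a1 + a2 * k ^ N) * exp (- w * t)"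
        using f_le[of k] k(3) by (intro mult_right_mono) (auto simp: N_def)
      also have "\<dots> = a1 * exp (- w * t) + a2 * (k ^ N * exp (- w * t))"
        by (simp add: algebra_simps)
      also have "\<dots> \<le> a1 * 1 + a2 * P"
        using a w t time_decay[OF t1] by (intro add_mono mult_left_mono) (auto simp: k_def)
      also have "\<dots> \<le> a1 + a2 * (P + Q + P * Q)"
        using a PQ by (simp add: mult_left_mono)
      finally have "f k * exp (- w * t) \<le> a1 + a2 * (P + Q + P * Q)" .
      then have "e * V * (f k * exp (- w * t)) \<le> e * V * (a1 + a2 * (P + Q + P * Q))"
        using e V0 by (intro mult_left_mono) auto
      moreover have "e * d * 1 \<le> e * d * (1 + Q)"
        using e d PQ by (intro mult_left_mono) auto
      ultimately show ?thesis by linarith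
    qed
    also have "\<dots> \<le> C" unfolding C using parts by linarith
    finally show ?thesis by (simp add: C_def k_def)
  qed
  show "f (norm x) * U \<le> bound_const a1 a2 V k0 (D * B)"
  proof (cases "norm x \<le> max k0 1")
    case True
    then show ?thesis
      using small[of "norm x"] by (simp add: C_def)
  next
    case False
    define k where "k = norm x"
    have k: "max k0 1 \<le> k" "1 \<le> k" "0 < k" using False by (auto simp: k_def)
    \<comment> \<open>The longest tilt allowed by both |l| \<le> 1 and t |l|^2 \<le> 1.\<close>
    define \<sigma> where "\<sigma> = min 1 (1 / sqrt t)"
    have \<sigma>: "0 < \<sigma>" "\<sigma> \<le> 1" using t by (auto simp: \<sigma>_def)
    have t\<sigma>: "t * \<sigma>\<^sup>2 \<le> 1"
    proof -
      have "\<sigma>\<^sup>2 \<le> (1 / sqrt t)\<^sup>2" using \<sigma> by (intro power_mono) (auto simp: \<sigma>_def)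
      then show ?thesis using t by (simp add: power_divide field_simps)
    qed
    define l where "l = (\<sigma> / k) *\<^sub>R x"
    have l: "norm l = \<sigma>" "l \<bullet> x = \<sigma> * k"
      using \<sigma> k(3) by (simp_all add: l_def k_def power2_norm_eq_inner[symmetric] power2_eq_square)
    have farx: "v y \<le> D * B / f k" if "k / 2 \<le> norm y" for y
      using that k by (intro far) auto
    have c0: "0 \<le> D * B / f k"
      using D B f_pos[OF k(3)] by simp
    \<comment> \<open>The tilt gains \<sigma> k at x and loses at most \<sigma> k / 2 on the inner
      ball of radius k/2.\<close>
    have expo: "exp (rate + norm l * (k / 2) - l \<bullet> x) = e * exp (- (\<sigma> * k / 2))"
      unfolding l e_def by (simp add: exp_add[symmetric] algebra_simps)
    have nf: "U \<le> e * exp (- (\<sigma> * k / 2)) * (exp (- w * t) * V + d / sqrt t ^ N * mass (k / 2)) + D * B / f k"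
        "U \<le> e * exp (- (\<sigma> * k / 2)) * V + D * B / f k"
      using near_far[of "k / 2" "D * B / f k" l, OF farx c0, unfolded expo] \<sigma> t\<sigma> by (simp_all only: l)
    have space_decay: "(\<sigma> * k) ^ N * exp (- (\<sigma> * k / 2)) \<le> Q"
      using power_mult_exp_neg_le[of "1/2" "\<sigma> * k" N] \<sigma> k(3) by (simp add: Q_def power_one_over)
    show ?thesis
    proof (cases "t \<le> 1")
      case True
      \<comment> \<open>At times up to 1 the tilt has full length, its decay in k absorbs k^N, and
        the sup bound suffices.\<close>
      then have "\<sigma> = 1" using t by (auto simp: \<sigma>_def min_def)
      have "f k * U \<le> f k * (e * exp (- (\<sigma> * k / 2)) * V + D * B / f k)"
        using f_pos[OF k(3)] nf(2) by (intro mult_left_mono) auto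
      also have "\<dots> = e * V * (f k * exp (- (\<sigma> * k / 2))) + D * B"
        using f_pos[OF k(3)] by (simp add: algebra_simps)
      also have "\<dots> \<le> e * V * (a1 + a2 * (P + Q + P * Q)) + D * B"
      proof -
        have "f k * exp (- (\<sigma> * k / 2)) \<le> (a1 + a2 * k ^ N) * exp (- (\<sigma> * k / 2))"
          using f_le[of k] k(3) by (intro mult_right_mono) (auto simp: N_def)
        also have "\<dots> = a1 * exp (- (\<sigma> * k / 2)) + a2 * ((\<sigma> * k) ^ N * exp (- (\<sigma> * k / 2)))"
          using \<open>\<sigma> = 1\<close> by (simp add: algebra_simps)
        also have "\<dots> \<le> a1 * 1 + a2 * Q"
          using a \<sigma> k(3) space_decay by (intro add_mono mult_left_mono) auto
        also have "\<dots> \<le> a1 + a2 * (P + Q + P * Q)"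
          using a PQ by (simp add: mult_left_mono)
        finally show ?thesis
          using e V0 by (intro add_right_mono mult_left_mono) auto
      qed
      also have "\<dots> \<le> C" unfolding C using parts by linarith
      finally show ?thesis by (simp add: C_def k_def)
    next
      case False
      then have t1: "1 \<le> t" by simp
      have \<sigma>t: "\<sigma> = 1 / sqrt t" using t1 by (auto simp: \<sigma>_def min_def divide_le_eq)
      let ?E = "exp (- (\<sigma> * k / 2))"
      have "f k * U \<le> f k * (e * ?E * (exp (- w * t) * V + d / sqrt t ^ N * mass (k / 2)) + D * B / f k)"
        using f_pos[OF k(3)] nf(1) by (intro mult_left_mono) auto
      also have "\<dots> = e * V * (f k * exp (- w * t) * ?E) + e * d * (?E * (f k * mass (k / 2) / sqrt t ^ N)) + D * B"
        using f_pos[OF k(3)] by (simp add: algebra_simps)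
      also have "\<dots> \<le> e * V * (a1 + a2 * (P + Q + P * Q)) + e * d * (1 + Q) + D * B"
      proof -
        \<comment> \<open>Distributes k^N over the two exponentials: exp(-w t) absorbs the power of
          sqrt t, the tilt that of \<sigma> k.\<close>
        have kt: "k ^ N = (\<sigma> * k) ^ N * sqrt t ^ N"
          using t by (simp add: \<sigma>t power_mult_distrib[symmetric])
        have one: "exp (- w * t) * ?E \<le> 1 * 1"
          using w t \<sigma> k(3) by (intro mult_mono) auto
        have "f k * exp (- w * t) * ?E \<le> (a1 + a2 * k ^ N) * (exp (- w * t) * ?E)"
          unfolding mult.assoc using f_le[of k] k(3) by (intro mult_right_mono) (auto simp: N_def)
        also have "\<dots> = a1 * (exp (- w * t) * ?E) + a2 * ((sqrt t ^ N * exp (- w * t)) * ((\<sigma> * k) ^ N * ?E))"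
          unfolding kt by (simp add: algebra_simps)
        also have "\<dots> \<le> a1 * 1 + a2 * (P * Q)"
        proof (intro add_mono mult_left_mono a)
          show "sqrt t ^ N * exp (- w * t) * ((\<sigma> * k) ^ N * ?E) \<le> P * Q"
            using time_decay[OF t1] space_decay PQ \<sigma> k(3) by (intro mult_mono) auto
        qed (use one in simp)
        also have "\<dots> \<le> a1 + a2 * (P + Q + P * Q)"
          using a PQ by (simp add: mult_left_mono)
        finally have "e * V * (f k * exp (- w * t) * ?E) \<le> e * V * (a1 + a2 * (P + Q + P * Q))"
          using e V0 by (intro mult_left_mono) auto
        moreover have "?E * (f k * mass (k / 2) / sqrt t ^ N) \<le> 1 + Q"
        proof -
          \<comment> \<open>By monotonicity f(k) mass(k/2) is at most k^N; divided by t^(N/2) this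
            is (\<sigma> k)^N, which the tilt absorbs.\<close>
          have "ennreal (mass (k / 2)) \<le> ennreal (mass k)"
            unfolding mass using k(3) by (intro nn_integral_mono) (auto simp: indicator_def)
          then have "mass (k / 2) \<le> mass k"
            using mass_nonneg by simp
          then have "f k * mass (k / 2) \<le> f k * mass k"
            using f_pos[OF k(3)] by simp
          also have "\<dots> = k ^ N"
            using mass_pos[OF k(3)] by (simp add: f N_def)
          finally have "f k * mass (k / 2) / sqrt t ^ N \<le> k ^ N / sqrt t ^ N"
            using t by (intro divide_right_mono) auto
          also have "\<dots> = (\<sigma> * k) ^ N"
            using t by (simp add: kt)
          finally have "?E * (f k * mass (k / 2) / sqrt t ^ N) \<le> ?E * (\<sigma> * k) ^ N"
            by (rule mult_left_mono) simp
          then show ?thesis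
            using space_decay by (simp add: mult.commute)
        qed
        then have "e * d * (?E * (f k * mass (k / 2) / sqrt t ^ N)) \<le> e * d * (1 + Q)"
          using e d by (intro mult_left_mono) auto
        ultimately show ?thesis by linarith
      qed
      also have "\<dots> \<le> C" unfolding C using parts by linarith
      finally show ?thesis by (simp add: C_def k_def)
    qed
  qed
qed

end

end

section \<open>Initial data\<close>

text \<open>Links the mass of the class \<open>u0\<close> to a Borel representative, to which the
  convolution estimates apply.\<close>

lemma ball_mass_eq_nn_integral:
  fixes u0 v :: "'a::euclidean_space \<Rightarrow> real"
  assumes [measurable]: "u0 \<in> borel_measurable lebesgue" "v \<in> borel_measurable borel"
    and ae: "AE x in lebesgue. u0 x = v x" and v: "\<And>y. 0 \<le> v y" "\<And>y. v y \<le> V"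
  shows "0 \<le> (LINT x:ball 0 k|lebesgue. u0 x)"
    and "ennreal (LINT x:ball 0 k|lebesgue. u0 x) = (\<integral>\<^sup>+ y. ennreal (v y) * indicator (ball 0 k) y \<partial>lborel)"
proof -
  have meas: "(\<lambda>x. indicator (ball 0 k) x * v x) \<in> borel_measurable borel"
    by (simp add: borel_measurable_times borel_measurable_indicator)
  have [measurable]: "v \<in> borel_measurable lebesgue"
    by (rule measurable_completion) simp
  have [measurable]: "ball 0 k \<in> sets (lebesgue :: 'a measure)"
    by (intro sets_completionI_sets) simp
  have "(LINT x:ball 0 k|lebesgue. u0 x) = (LINT x|lebesgue. indicator (ball 0 k) x * v x)"
    unfolding set_lebesgue_integral_def
  proof (rule integral_cong_AE)
    show "AE x in lebesgue. indicator (ball 0 k) x *\<^sub>R u0 x = indicator (ball 0 k) x * v x"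
      using ae by eventually_elim simp
  qed measurable
  also have "\<dots> = (LINT x|lborel. indicator (ball 0 k) x * v x)"
    using meas by (intro integral_completion) simp
  finally have eq: "(LINT x:ball 0 k|lebesgue. u0 x) = (LINT x|lborel. indicator (ball 0 k) x * v x)" .
  then show "0 \<le> (LINT x:ball 0 k|lebesgue. u0 x)"
    using v by (simp add: integral_nonneg_AE)
  have "integrable lborel (\<lambda>x. indicator (ball 0 k) x * v x)"
  proof (rule Bochner_Integration.integrable_bound)
    show "integrable lborel (\<lambda>x. V * indicator (ball (0::'a) k) x)"
      using emeasure_bounded_finite[OF bounded_ball, of "0::'a" k] by (intro integrable_mult_right integrable_real_indicator) auto
    show "AE x in lborel. norm (indicator (ball 0 k) x * v x) \<le> norm (V * indicator (ball 0 k) x)"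
      using v order_trans[OF v] by (intro always_eventually) (auto simp: indicator_def)
  qed (use meas in simp)
  then have "(\<integral>\<^sup>+ y. ennreal (indicator (ball 0 k) y * v y) \<partial>lborel) = ennreal (LINT x|lborel. indicator (ball 0 k) x * v x)"
    using v by (intro nn_integral_eq_integral) auto
  moreover have "ennreal (indicator (ball 0 k) y * v y) = ennreal (v y) * indicator (ball 0 k) y" for y
    by (auto simp: indicator_def)
  ultimately show "ennreal (LINT x:ball 0 k|lebesgue. u0 x) = (\<integral>\<^sup>+ y. ennreal (v y) * indicator (ball 0 k) y \<partial>lborel)"
    by (simp add: eq)
qed

text \<open>A Borel version is clamped between 0 and |M|; the absolute value makes these limits
  consistent without first determining the sign of M.\<close>

lemma initial_datum_borel:
  fixes u0 :: "'a::euclidean_space \<Rightarrow> real"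
  assumes "initial_datum M \<kappa> k1 u0"
  obtains v where "v \<in> borel_measurable borel" "\<And>y. 0 \<le> v y" "\<And>y. v y \<le> \<bar>M\<bar>" "AE x in lebesgue. u0 x = v x"
proof -
  have meas: "u0 \<in> borel_measurable lebesgue" and norm: "Linf_norm u0 = ereal M"
    and nonneg: "AE x in lebesgue. 0 \<le> u0 x"
    using assms by (auto simp: initial_datum_def)
  obtain w where w: "w \<in> borel_measurable lborel" "AE x in lborel. u0 x = w x"
    using completion_ex_borel_measurable_real[OF meas] by blast
  have "AE x in lebesgue. ereal \<bar>u0 x\<bar> \<le> ereal M"
    using esssup_AE[of "\<lambda>x. ereal \<bar>u0 x\<bar>" lebesgue] norm by (simp add: Linf_norm_def)
  then have "AE x in lebesgue. u0 x = max 0 (min \<bar>M\<bar> (w x))"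
    using nonneg AE_completion[OF w(2)] by eventually_elim auto
  then show ?thesis
    using w(1) by (intro that[of "\<lambda>x. max 0 (min \<bar>M\<bar> (w x))"]) auto
qed

section \<open>Mass of balls and growth of the mass ratio\<close>

lemma ball_mass_nonneg:
  assumes "initial_datum M \<kappa> k1 u0"
  shows "0 \<le> (LINT x:ball 0 k|lebesgue. u0 x)"
proof -
  obtain v where "v \<in> borel_measurable borel" "\<And>y. 0 \<le> v y" "\<And>y. v y \<le> \<bar>M\<bar>" "AE x in lebesgue. u0 x = v x"
    using initial_datum_borel[OF assms] by blast
  then show ?thesis
    using assms by (intro ball_mass_eq_nn_integral(1)) (auto simp: initial_datum_def)
qed

lemma ball_mass_mono:
  fixes u0 :: "'a::euclidean_space \<Rightarrow> real"
  assumes "initial_datum M \<kappa> k1 u0" "k \<le> l"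
  shows "(LINT x:ball 0 k|lebesgue. u0 x) \<le> (LINT x:ball 0 l|lebesgue. u0 x)"
proof -
  obtain v where v: "v \<in> borel_measurable borel" "\<And>y. 0 \<le> v y" "\<And>y. v y \<le> \<bar>M\<bar>" "AE x in lebesgue. u0 x = v x"
    using initial_datum_borel[OF assms(1)] by blast
  have meas: "u0 \<in> borel_measurable lebesgue"
    using assms(1) by (simp add: initial_datum_def)
  have "ennreal (LINT x:ball 0 k|lebesgue. u0 x) \<le> ennreal (LINT x:ball 0 l|lebesgue. u0 x)"
    unfolding ball_mass_eq_nn_integral(2)[OF meas v(1) v(4) v(2,3)]
    using assms(2) by (intro nn_integral_mono) (auto simp: indicator_def)
  then show ?thesis
    using ball_mass_nonneg[OF assms(1), of l] by (simp add: ennreal_le_iff)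
qed

text \<open>Small balls carry mass by assumption, and monotonicity extends this to all
  radii.\<close>

lemma ball_mass_pos:
  fixes u0 :: "'a::euclidean_space \<Rightarrow> real"
  assumes "initial_datum M \<kappa> k1 u0" "0 < k"
  shows "0 < (LINT x:ball 0 k|lebesgue. u0 x)"
proof -
  have k1: "\<kappa> > 0" "k1 > 0" "\<And>k. 0 < k \<and> k < k1 \<Longrightarrow> \<kappa> * k ^ DIM('a) \<le> (LINT x:ball 0 k|lebesgue. u0 x)"
    using assms(1) by (auto simp: initial_datum_def)
  define l where "l = min k (k1 / 2)"
  have l: "0 < l" "l < k1" "l \<le> k" using k1 assms(2) by (auto simp: l_def)
  have "0 < \<kappa> * l ^ DIM('a)" using k1 l by simp
  also have "\<dots> \<le> (LINT x:ball 0 l|lebesgue. u0 x)" using k1(3) l by simp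
  also have "\<dots> \<le> (LINT x:ball 0 k|lebesgue. u0 x)" using assms(1) l(3) by (rule ball_mass_mono)
  finally show ?thesis .
qed

lemma mass_ratio_pos: "initial_datum M \<kappa> k1 u0 \<Longrightarrow> 0 < k \<Longrightarrow> 0 < mass_ratio u0 k"
  by (simp add: mass_ratio_def ball_mass_pos)

text \<open>Below \<open>k1\<close> the lower bound on the mass gives 1/\<kappa>. From
  \<open>k1\<close> on the mass is at least that of radius k1/2, where the bound, stated strictly
  below \<open>k1\<close>, still applies.\<close>

lemma mass_ratio_le:
  fixes u0 :: "'a::euclidean_space \<Rightarrow> real"
  assumes "initial_datum M \<kappa> k1 u0" "0 \<le> k"
  shows "mass_ratio u0 k \<le> 1 / \<kappa> + 1 / (\<kappa> * (k1 / 2) ^ DIM('a)) * k ^ DIM('a)"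
proof -
  let ?m = "\<lambda>k. LINT x:ball 0 k|lebesgue. u0 x"
  have k1: "\<kappa> > 0" "k1 > 0" "\<And>k. 0 < k \<and> k < k1 \<Longrightarrow> \<kappa> * k ^ DIM('a) \<le> ?m k"
    using assms(1) by (auto simp: initial_datum_def)
  have nonneg: "0 \<le> 1 / \<kappa>" "0 \<le> 1 / (\<kappa> * (k1 / 2) ^ DIM('a)) * k ^ DIM('a)"
    using k1 assms(2) by auto
  consider "k = 0" | "0 < k" "k < k1" | "k1 \<le> k" using assms(2) by linarith
  then show ?thesis
  proof cases
    case 1
    then show ?thesis using nonneg(1) by (simp add: mass_ratio_def power_0_left)
  next
    case 2
    have "mass_ratio u0 k \<le> k ^ DIM('a) / (\<kappa> * k ^ DIM('a))"
      unfolding mass_ratio_def using k1 2 by (intro divide_left_mono mult_pos_pos ball_mass_pos[OF assms(1)]) auto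
    also have "\<dots> = 1 / \<kappa>" using 2 by simp
    finally show ?thesis using nonneg by linarith
  next
    case 3
    have "\<kappa> * (k1 / 2) ^ DIM('a) \<le> ?m (k1 / 2)" using k1 by simp
    also have "\<dots> \<le> ?m k" using 3 k1 by (intro ball_mass_mono[OF assms(1)]) simp
    finally have "mass_ratio u0 k \<le> k ^ DIM('a) / (\<kappa> * (k1 / 2) ^ DIM('a))"
      unfolding mass_ratio_def using k1 3 by (intro divide_left_mono mult_pos_pos ball_mass_pos[OF assms(1)]) auto
    then show ?thesis using nonneg(1) by (simp add: add_increasing)
  qed
qed

text \<open>Redefining the representative on a null set makes the pointwise decay (F1) hold everywhere, which
  is needed because it is used at the points \<^term>\<open>y\<close> outside balls of varying radius.\<close>

lemma initial_datum_borel_F1: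
  fixes u0 :: "'a::euclidean_space \<Rightarrow> real"
  assumes "initial_datum M \<kappa> k1 u0" "F1 B u0"
  obtains v where "v \<in> borel_measurable borel" "\<And>y. 0 \<le> v y" "\<And>y. v y \<le> \<bar>M\<bar>"
    "AE x in lebesgue. u0 x = v x" "\<And>y. mass_ratio u0 (norm y) * v y \<le> B"
proof -
  obtain w where w: "w \<in> borel_measurable borel" "\<And>y. 0 \<le> w y" "\<And>y. w y \<le> \<bar>M\<bar>" "AE x in lebesgue. u0 x = w x"
    using initial_datum_borel[OF assms(1)] by blast
  \<comment> \<open>A monotone function is Borel, so the set where (F1) fails can be cut out
    measurably.\<close>
  have "mono (\<lambda>k. LINT x:ball 0 k|lebesgue. u0 x)"
    by (intro monoI ball_mass_mono[OF assms(1)])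
  then have [measurable]: "(\<lambda>k. LINT x:ball 0 k|lebesgue. u0 x) \<in> borel_measurable borel"
    by (rule borel_measurable_mono)
  have [measurable]: "mass_ratio u0 \<in> borel_measurable borel"
    unfolding mass_ratio_def[abs_def] by measurable
  have B: "0 < B" "AE x in lebesgue. mass_ratio u0 (norm x) * u0 x \<le> B"
    using assms(2) by (auto simp: F1_def)
  define v where "v y = (if mass_ratio u0 (norm y) * w y \<le> B then w y else 0)" for y
  have "v \<in> borel_measurable borel"
    unfolding v_def[abs_def] using w(1) by measurable
  moreover have "AE x in lebesgue. u0 x = v x"
    using B(2) w(4) by eventually_elim (simp add: v_def)
  ultimately show ?thesis
    using w B(1) by (intro that[of v]) (auto simp: v_def)
qed

lemma (in minorized_kernel) nonlocal_solution_bounds: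
  fixes u :: "'a \<Rightarrow> real \<Rightarrow> real"
  assumes u0: "initial_datum M \<kappa> k1 u0" "F1 B u0" "F2 k0 D u0" and sol: "nonlocal_solution J u0 u"
  defines "C \<equiv> bound_const (1 / \<kappa>) (1 / (\<kappa> * (k1 / 2) ^ DIM('a))) \<bar>M\<bar> k0 (D (1 / 2) * B)"
  shows "AE x in lebesgue. \<forall>t>0. u x t \<le> exp rate * \<bar>M\<bar> \<and>
    mass_ratio u0 (sqrt t) * u x t \<le> C \<and> mass_ratio u0 (norm x) * u x t \<le> C"
proof -
  obtain v where v: "v \<in> borel_measurable borel" "\<And>y. 0 \<le> v y" "\<And>y. v y \<le> \<bar>M\<bar>"
    "AE x in lebesgue. u0 x = v x" "\<And>y. mass_ratio u0 (norm y) * v y \<le> B"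
    using initial_datum_borel_F1[OF u0(1,2)] by blast
  have meas: "u0 \<in> borel_measurable lebesgue" and \<kappa>: "\<kappa> > 0" "k1 > 0"
    using u0(1) by (auto simp: initial_datum_def)
  have B: "0 \<le> B" using u0(2) by (simp add: F1_def)
  \<comment> \<open>\<delta> = 1/2 turns the condition k \<le> l / \<delta> into k \<le> 2
    l.\<close>
  have "D (1 / 2) > 0 \<and> (\<forall>k l. k0 \<le> k \<and> k \<le> l * inverse (1 / 2) \<longrightarrow> mass_ratio u0 k \<le> D (1 / 2) * mass_ratio u0 l)"
    using u0(3) unfolding F2_def by (meson half_gt_zero zero_less_one)
  then have D: "D (1 / 2) > 0" "\<And>k l. k0 \<le> k \<Longrightarrow> k \<le> 2 * l \<Longrightarrow> mass_ratio u0 k \<le> D (1 / 2) * mass_ratio u0 l"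
    by (auto simp: mult.commute)
  have coeffs: "0 \<le> 1 / \<kappa>" "0 \<le> 1 / (\<kappa> * (k1 / 2) ^ DIM('a))" using \<kappa> by auto
  show ?thesis
    using nonlocal_solution_le[OF v(1-3) sol v(4)]
  proof eventually_elim
    case (elim x)
    show ?case
    proof (intro allI impI)
      fix t :: real assume t: "0 < t"
      show "u x t \<le> exp rate * \<bar>M\<bar> \<and> mass_ratio u0 (sqrt t) * u x t \<le> C \<and> mass_ratio u0 (norm x) * u x t \<le> C"
        unfolding C_def
        using weighted_bounds[OF v(1-3), where f = "mass_ratio u0" and mass = "\<lambda>k. LINT x:ball 0 k|lebesgue. u0 x"
            and D = "D (1/2)" and B = B and t = t and U = "u x t" and x = x,
            OF ball_mass_eq_nn_integral(2)[OF meas v(1,4,2,3)] ball_mass_nonneg[OF u0(1)] ball_mass_pos[OF u0(1)]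
            mass_ratio_def mass_ratio_le[OF u0(1)] coeffs D(2) less_imp_le[OF D(1)] v(5) B t] elim t
        by blast
    qed
  qed
qed

text \<open>For large k (F3) gives k^2 \<le> (c0 + 1) f(k)^(p-1), and taking a root yields the
  claim. On the remaining range 1 \<le> k < L the ratio is at least the inverse of the mass of the
  ball of radius L.\<close>

lemma powr_le_mass_ratio:
  fixes u0 :: "'a::euclidean_space \<Rightarrow> real"
  assumes u0: "initial_datum M \<kappa> k1 u0" and F3: "F3 p c0 u0"
  shows "\<exists>A>0. \<forall>k\<ge>1. k powr (2 / (p - 1)) \<le> A * mass_ratio u0 k"
proof -
  have p: "p > 1" and c0: "c0 \<ge> 0"
    and lim: "((\<lambda>k. mass_ratio u0 k powr (1 - p) * k ^ 2) \<longlongrightarrow> c0) at_top"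
    using F3 by (auto simp: F3_def)
  let ?a = "2 / (p - 1)"
  \<comment> \<open>Any number above the limit would do; c0 + 1 is positive even if c0 is 0.\<close>
  have "eventually (\<lambda>k. mass_ratio u0 k powr (1 - p) * k ^ 2 < c0 + 1) at_top"
    using lim by (rule order_tendstoD) simp
  then obtain K where K: "\<And>k. K \<le> k \<Longrightarrow> mass_ratio u0 k powr (1 - p) * k ^ 2 < c0 + 1"
    unfolding eventually_at_top_linorder by blast
  define L where "L = max K 1"
  have L: "1 \<le> L" "K \<le> L" by (auto simp: L_def)
  let ?m = "\<lambda>k. LINT x:ball 0 k|lebesgue. u0 x"
  have mL: "0 < ?m L" using L by (intro ball_mass_pos[OF u0]) auto
  \<comment> \<open>One summand for each of the ranges k \<ge> L and k < L.\<close>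
  define A where "A = (c0 + 1) powr (1 / (p - 1)) + L powr ?a * ?m L"
  have A: "0 < A" using c0 mL L by (auto simp: A_def intro!: add_pos_pos)
  have "k powr ?a \<le> A * mass_ratio u0 k" if k: "1 \<le> k" for k
  proof -
    define f where "f = mass_ratio u0 k"
    have f: "0 < f" using mass_ratio_pos[OF u0, of k] k by (simp add: f_def)
    show ?thesis
    proof (cases "L \<le> k")
      case True
      have "f powr (1 - p) * k ^ 2 \<le> c0 + 1"
        using K[of k] True L by (simp add: f_def)
      then have "k ^ 2 \<le> (c0 + 1) * f powr (p - 1)"
        using f by (simp add: powr_diff field_simps)
      then have "(k ^ 2) powr (1 / (p - 1)) \<le> ((c0 + 1) * f powr (p - 1)) powr (1 / (p - 1))"
        using p by (intro powr_mono2) auto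
      also have "\<dots> = (c0 + 1) powr (1 / (p - 1)) * f"
        using p c0 f by (simp add: powr_mult powr_powr)
      also have "\<dots> \<le> A * f"
        using f mL L by (intro mult_right_mono) (auto simp: A_def)
      also have "(k ^ 2) powr (1 / (p - 1)) = k powr ?a"
        using k by (simp add: powr_numeral[symmetric] powr_powr del: powr_numeral)
      finally show ?thesis by (simp add: f_def)
    next
      case False
      have "k powr ?a \<le> L powr ?a"
        using False k p by (intro powr_mono2) auto
      also have "\<dots> = L powr ?a * ?m L * (1 / ?m L)"
        using mL by simp
      also have "\<dots> \<le> L powr ?a * ?m L * f"
      proof (intro mult_left_mono)
        have "1 / ?m L \<le> 1 / ?m k"
          using False k by (intro divide_left_mono ball_mass_mono[OF u0] mult_pos_pos ball_mass_pos[OF u0]) auto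
        also have "\<dots> \<le> f"
          unfolding f_def mass_ratio_def using k ball_mass_nonneg[OF u0] by (intro divide_right_mono) auto
        finally show "1 / ?m L \<le> f" .
      qed (use mL in simp)
      also have "\<dots> \<le> A * f"
        using f by (intro mult_right_mono) (auto simp: A_def)
      finally show ?thesis by (simp add: f_def)
    qed
  qed
  with A show ?thesis by blast
qed

text \<open>With k = max(r, s) one has 1 + r + s \<le> 3 max(1, k). For k \<ge> 1 the weighted bound
  at k is used, otherwise the plain bound K.\<close>

lemma powr_decay:
  fixes u C K A \<mu> r s :: real and f :: "real \<Rightarrow> real"
  assumes "0 < \<mu>" "0 < A" "\<And>k. 1 \<le> k \<Longrightarrow> k powr \<mu> \<le> A * f k" "0 \<le> K" "0 \<le> C"
    and "u \<le> K" "f r * u \<le> C" "f s * u \<le> C" "0 \<le> r" "0 \<le> s"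
  shows "u \<le> 3 powr \<mu> * (A * C + K) / (1 + r + s) powr \<mu>"
\<comment> \<open>Nonpositive u is trivial; for positive u inequalities may be multiplied by
  u.\<close>
proof (cases "u \<le> 0")
  case True
  then show ?thesis
    using assms by (intro order_trans[OF True]) auto
next
  case False
  define k where "k = max r s"
  have pos: "0 < (1 + r + s) powr \<mu>" using assms by auto
  have "(1 + r + s) powr \<mu> * u \<le> 3 powr \<mu> * (A * C + K)"
  proof (cases "1 \<le> k")
    case True
    have "(1 + r + s) powr \<mu> \<le> (3 * k) powr \<mu>"
      using assms True by (intro powr_mono2) (auto simp: k_def)
    also have "\<dots> = 3 powr \<mu> * k powr \<mu>"
      using True by (simp add: powr_mult)
    also have "\<dots> \<le> 3 powr \<mu> * (A * f k)"
      using assms(3)[OF True] by (intro mult_left_mono) auto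
    finally have "(1 + r + s) powr \<mu> * u \<le> 3 powr \<mu> * (A * f k) * u"
      using False by (intro mult_right_mono) auto
    also have "\<dots> = 3 powr \<mu> * (A * (f k * u))" by simp
    also have "\<dots> \<le> 3 powr \<mu> * (A * C + K)"
    proof (intro mult_left_mono)
      have "A * (f k * u) \<le> A * C"
        using assms(2,7,8) by (intro mult_left_mono) (auto simp: k_def max_def)
      then show "A * (f k * u) \<le> A * C + K" using assms(4) by linarith
    qed simp
    finally show ?thesis .
  next
    case False
    have "(1 + r + s) powr \<mu> \<le> 3 powr \<mu>"
      using assms False by (intro powr_mono2) (auto simp: k_def)
    moreover have "u \<le> A * C + K"
      using assms mult_nonneg_nonneg[of A C] by linarith
    ultimately show ?thesis
      using \<open>\<not> u \<le> 0\<close> by (intro mult_mono) auto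
  qed
  then show ?thesis
    using pos by (simp add: le_divide_eq mult.commute)
qed

text \<open>Each decay constant is chosen before the datum, the solution and p, so it is uniform
  over them; time is quantified inside the almost-everywhere statement, so one null set serves all
  times.\<close>

theorem proposition2p1:
  fixes J :: "'a::euclidean_space \<Rightarrow> real"
    and M B \<kappa> k1 k0 :: real and D :: "real \<Rightarrow> real"
  assumes "diffusion_kernel J"
  shows
    "(\<exists>C>0. \<forall>u0 u p c0.
        initial_datum M \<kappa> k1 u0 \<and> F1 B u0 \<and> F2 k0 D u0 \<and> F3 p c0 u0 \<and> nonlocal_solution J u0 u \<longrightarrow>
        (AE x in lebesgue. \<forall>t>0.
           mass_ratio u0 (sqrt t) * u x t \<le> C \<and> mass_ratio u0 (norm x) * u x t \<le> C))
     \<and> (\<forall>\<mu>>0. \<forall>A>0. \<exists>C>0. \<forall>u0 u p c0.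
        initial_datum M \<kappa> k1 u0 \<and> F1 B u0 \<and> F2 k0 D u0 \<and> F3 p c0 u0 \<and> nonlocal_solution J u0 u \<and>
        (\<forall>k\<ge>1. k powr \<mu> \<le> A * mass_ratio u0 k) \<longrightarrow>
        (AE x in lebesgue. \<forall>t>0. u x t \<le> C / (1 + sqrt t + norm x) powr \<mu>))
     \<and> (\<forall>(u0 :: 'a \<Rightarrow> real) p c0.
        initial_datum M \<kappa> k1 u0 \<and> F1 B u0 \<and> F2 k0 D u0 \<and> F3 p c0 u0 \<longrightarrow>
        (\<exists>A>0. \<forall>k\<ge>1. k powr (2 / (p - 1)) \<le> A * mass_ratio u0 k))"
proof -
  obtain \<rho> \<theta> h a where "minorized_kernel J \<rho> \<theta> h a"
    using diffusion_kernel_minorized[OF assms] by blast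
  then interpret minorized_kernel J \<rho> \<theta> h a .
  define C0 where "C0 = bound_const (1 / \<kappa>) (1 / (\<kappa> * (k1 / 2) ^ DIM('a))) \<bar>M\<bar> k0 (D (1 / 2) * B)"
  \<comment> \<open>At this point \<kappa>, \<open>k1\<close> and the other parameters are arbitrary
    reals, so positivity of \<open>C0\<close> is not guaranteed.\<close>
  define C where "C = \<bar>C0\<bar> + 1"
  have C: "0 < C" "C0 \<le> C" by (auto simp: C_def)
  have bounds: "AE x in lebesgue. \<forall>t>0. u x t \<le> exp rate * \<bar>M\<bar> \<and>
      mass_ratio u0 (sqrt t) * u x t \<le> C \<and> mass_ratio u0 (norm x) * u x t \<le> C"
    if "initial_datum M \<kappa> k1 u0 \<and> F1 B u0 \<and> F2 k0 D u0 \<and> F3 p c0 u0 \<and> nonlocal_solution J u0 u" for u0 u p c0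
  proof -
    have "AE x in lebesgue. \<forall>t>0. u x t \<le> exp rate * \<bar>M\<bar> \<and>
      mass_ratio u0 (sqrt t) * u x t \<le> C0 \<and> mass_ratio u0 (norm x) * u x t \<le> C0"
      unfolding C0_def using that by (intro nonlocal_solution_bounds) auto
    then show ?thesis
      by eventually_elim (use C(2) in \<open>meson order_trans\<close>)
  qed
  show ?thesis
  proof (intro conjI)
    show "\<exists>C>0. \<forall>u0 u p c0.
        initial_datum M \<kappa> k1 u0 \<and> F1 B u0 \<and> F2 k0 D u0 \<and> F3 p c0 u0 \<and> nonlocal_solution J u0 u \<longrightarrow>
        (AE x in lebesgue. \<forall>t>0.
           mass_ratio u0 (sqrt t) * u x t \<le> C \<and> mass_ratio u0 (norm x) * u x t \<le> C)"
    proof (intro exI[of _ C] conjI allI impI)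
      fix u0 :: "'a \<Rightarrow> real" and u p c0
      assume "initial_datum M \<kappa> k1 u0 \<and> F1 B u0 \<and> F2 k0 D u0 \<and> F3 p c0 u0 \<and> nonlocal_solution J u0 u"
      from bounds[OF this]
      show "AE x in lebesgue. \<forall>t>0. mass_ratio u0 (sqrt t) * u x t \<le> C \<and> mass_ratio u0 (norm x) * u x t \<le> C"
        by eventually_elim blast
    qed (rule C)
    show "\<forall>\<mu>>0. \<forall>A>0. \<exists>C>0. \<forall>u0 u p c0.
        initial_datum M \<kappa> k1 u0 \<and> F1 B u0 \<and> F2 k0 D u0 \<and> F3 p c0 u0 \<and> nonlocal_solution J u0 u \<and>
        (\<forall>k\<ge>1. k powr \<mu> \<le> A * mass_ratio u0 k) \<longrightarrow>
        (AE x in lebesgue. \<forall>t>0. u x t \<le> C / (1 + sqrt t + norm x) powr \<mu>)"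
    proof (intro allI impI)
      fix \<mu> A :: real assume \<mu>: "0 < \<mu>" and A: "0 < A"
      \<comment> \<open>The constant of \<open>powr_decay\<close> with the sup bound
        \<open>exp rate * \<bar>M\<bar>\<close> as K.\<close>
      let ?C = "3 powr \<mu> * (A * C + exp rate * \<bar>M\<bar>)"
      show "\<exists>C>0. \<forall>u0 u p c0.
        initial_datum M \<kappa> k1 u0 \<and> F1 B u0 \<and> F2 k0 D u0 \<and> F3 p c0 u0 \<and> nonlocal_solution J u0 u \<and>
        (\<forall>k\<ge>1. k powr \<mu> \<le> A * mass_ratio u0 k) \<longrightarrow>
        (AE x in lebesgue. \<forall>t>0. u x t \<le> C / (1 + sqrt t + norm x) powr \<mu>)"
      proof (intro exI[of _ ?C] conjI allI impI)
        show "0 < ?C" using A C by (intro mult_pos_pos add_pos_nonneg) auto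
        fix u0 :: "'a \<Rightarrow> real" and u p c0
        assume *: "initial_datum M \<kappa> k1 u0 \<and> F1 B u0 \<and> F2 k0 D u0 \<and> F3 p c0 u0 \<and> nonlocal_solution J u0 u \<and>
          (\<forall>k\<ge>1. k powr \<mu> \<le> A * mass_ratio u0 k)"
        then have "AE x in lebesgue. \<forall>t>0. u x t \<le> exp rate * \<bar>M\<bar> \<and>
            mass_ratio u0 (sqrt t) * u x t \<le> C \<and> mass_ratio u0 (norm x) * u x t \<le> C"
          by (intro bounds) blast
        then show "AE x in lebesgue. \<forall>t>0. u x t \<le> ?C / (1 + sqrt t + norm x) powr \<mu>"
        proof eventually_elim
          case (elim x)
          show ?case
          proof (intro allI impI)
            fix t :: real assume "0 < t"
            then show "u x t \<le> ?C / (1 + sqrt t + norm x) powr \<mu>"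
              using elim * C(1) by (intro powr_decay[OF \<mu> A, where f = "mass_ratio u0"]) auto
          qed
        qed
      qed
    qed
    show "\<forall>(u0 :: 'a \<Rightarrow> real) p c0.
        initial_datum M \<kappa> k1 u0 \<and> F1 B u0 \<and> F2 k0 D u0 \<and> F3 p c0 u0 \<longrightarrow>
        (\<exists>A>0. \<forall>k\<ge>1. k powr (2 / (p - 1)) \<le> A * mass_ratio u0 k)"
      by (blast intro: powr_le_mass_ratio)
  qed
qed

end
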